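(* Let $\kappa$ be an uncountable regular cardinal. Let $\mathbb{P}$ be any forcing whose conditions are $\kappa$-Laver trees (i.e. $\mathbb{P}\subseteq\mathbb{L}_\kappa$, ordered by inclusion) and which is closed under the following operation: if $T\in\mathbb{P}$ and $\sigma\in T$ then $T\uparrow\sigma\in\mathbb{P}$. Then $\mathbb{P}$ adds a Cohen $\kappa$-real.
   Context: A tree is a subset of $\kappa^{<\kappa}$ closed under initial segments. A tree $T$ is limit-closed if for every limit ordinal $\lambda<\kappa$ and every $\subseteq$-increasing sequence $\langle\sigma_\alpha:\alpha<\lambda\rangle$ of elements of $T$, $\bigcup_{\alpha<\lambda}\sigma_\alpha\in T$. A $\kappa$-Laver tree is a limit-closed tree $T\subseteq\kappa^{<\kappa}$ such that every $\sigma\in T$ extending $\mathrm{stem}(T)$ (the maximal node comparable with all nodes of $T$) has $|\mathrm{Succ}_T(\sigma)|=\kappa$, where $\mathrm{Succ}_T(\sigma)=\{\beta:\sigma^\frown\langle\beta\rangle\in T\}$. $\mathbb{L}_\kappa$ is the set of all $\kappa$-Laver trees ordered by inclusion. For $\sigma\in T$, $T\uparrow\sigma=\{\tau\in T:\sigma\subseteq\tau\lor\tau\subseteq\sigma\}$. $\kappa$-Cohen forcing is $2^{<\kappa}$ ordered by end-extension (equivalently, basic open sets $[t]=\{z\in2^\kappa:t\subseteq z\}$ ordered by inclusion); a Cohen $\kappa$-real over $V$ is an element of $2^\kappa$ generic over $V$ for $\kappa$-Cohen forcing. "$\mathbb{P}$ adds a Cohen $\kappa$-real" means every $\mathbb{P}$-generic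 extension contains one. *)

theory Defs
  imports Main
begin

unbundle cardinal_syntax

section \<open>Sequences of length below \<open>\<kappa>\<close> and \<open>\<kappa>\<close>-Laver trees\<close>

text \<open>The cardinal \<open>\<kappa>\<close> is the order of a well-ordered type \<open>'k\<close>; that it is an uncountable regular
  cardinal is an assumption on this relation. The elements of \<open>'k\<close> are the ordinals below \<open>\<kappa>\<close>.\<close>

definition kappa :: "'k::wellorder rel" where
  "kappa = {(\<alpha>, \<beta>). \<alpha> \<le> \<beta>}"

text \<open>With values in \<open>'k\<close> this is \<open>\<kappa>\<^bsup><\<kappa>\<^esup>\<close>, with values in \<^typ>\<open>bool\<close> it is \<open>2\<^bsup><\<kappa>\<^esup>\<close>. Inclusion of
  sequences is \<open>\<subseteq>\<^sub>m\<close>.\<close>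

definition seqs :: "('k::wellorder \<rightharpoonup> 'b) set" where
  "seqs = {\<sigma>. \<exists>\<alpha>. dom \<sigma> = {..<\<alpha>}}"

definition tree :: "('k::wellorder \<rightharpoonup> 'k) set \<Rightarrow> bool" where
  "tree T \<longleftrightarrow> T \<subseteq> seqs \<and> (\<forall>\<sigma>\<in>T. \<forall>\<tau>\<in>seqs. \<tau> \<subseteq>\<^sub>m \<sigma> \<longrightarrow> \<tau> \<in> T)"

definition limit_ordinal :: "'k::wellorder \<Rightarrow> bool" where
  "limit_ordinal \<delta> \<longleftrightarrow> (\<exists>\<alpha>. \<alpha> < \<delta>) \<and> (\<forall>\<alpha><\<delta>. \<exists>\<beta><\<delta>. \<alpha> < \<beta>)"

text \<open>The union of an increasing sequence of partial maps is the partial map \<open>u\<close> whose graph is the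
  union of the graphs.\<close>

definition limit_closed :: "('k::wellorder \<rightharpoonup> 'k) set \<Rightarrow> bool" where
  "limit_closed T \<longleftrightarrow>
     (\<forall>(\<delta>::'k) s u. limit_ordinal \<delta> \<and> (\<forall>\<alpha><\<delta>. s \<alpha> \<in> T) \<and> (\<forall>\<alpha> \<beta>. \<alpha> < \<beta> \<and> \<beta> < \<delta> \<longrightarrow> s \<alpha> \<subseteq>\<^sub>m s \<beta>) \<and>
        Map.graph u = (\<Union>\<alpha>\<in>{..<\<delta>}. Map.graph (s \<alpha>)) \<longrightarrow> u \<in> T)"

definition comparable_with_all :: "('k::wellorder \<rightharpoonup> 'k) set \<Rightarrow> ('k \<rightharpoonup> 'k) \<Rightarrow> bool" where
  "comparable_with_all T \<sigma> \<longleftrightarrow> (\<forall>\<tau>\<in>T. \<sigma> \<subseteq>\<^sub>m \<tau> \<or> \<tau> \<subseteq>\<^sub>m \<sigma>)"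

definition is_stem :: "('k::wellorder \<rightharpoonup> 'k) set \<Rightarrow> ('k \<rightharpoonup> 'k) \<Rightarrow> bool" where
  "is_stem T \<sigma> \<longleftrightarrow> \<sigma> \<in> T \<and> comparable_with_all T \<sigma> \<and>
     (\<forall>\<tau>\<in>T. comparable_with_all T \<tau> \<and> \<sigma> \<subseteq>\<^sub>m \<tau> \<longrightarrow> \<tau> = \<sigma>)"

definition Succ :: "('k::wellorder \<rightharpoonup> 'k) set \<Rightarrow> ('k \<rightharpoonup> 'k) \<Rightarrow> 'k set" where
  "Succ T \<sigma> = {\<beta>. \<exists>\<alpha>. dom \<sigma> = {..<\<alpha>} \<and> \<sigma>(\<alpha> \<mapsto> \<beta>) \<in> T}"

text \<open>Having a stem is part of the definition; in particular a Laver tree is nonempty.\<close>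

definition Laver_trees :: "('k::wellorder \<rightharpoonup> 'k) set set" where
  "Laver_trees = {T. tree T \<and> limit_closed T \<and>
     (\<exists>s. is_stem T s \<and> (\<forall>\<sigma>\<in>T. s \<subseteq>\<^sub>m \<sigma> \<longrightarrow> |Succ T \<sigma>| =o (kappa :: 'k rel)))}"

definition restrict_tree :: "('k::wellorder \<rightharpoonup> 'k) set \<Rightarrow> ('k \<rightharpoonup> 'k) \<Rightarrow> ('k \<rightharpoonup> 'k) set"
    (infixl "\<up>" 75) where
  "T \<up> \<sigma> = {\<tau> \<in> T. \<sigma> \<subseteq>\<^sub>m \<tau> \<or> \<tau> \<subseteq>\<^sub>m \<sigma>}"


section \<open>Names and the forcing relation\<close>

text \<open>The ground model is the ambient universe of sets over the given types, and truth in all generic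
  extensions is expressed by the forcing relation. A name is a set of pairs of a name and a
  condition; the set is given as the range of a family indexed by \<open>'i\<close>, so the names are those with
  hereditarily at most \<open>|'i|\<close> many elements.\<close>

datatype ('i, 'p) name = Name "'i \<Rightarrow> (('i, 'p) name \<times> 'p) option"

primrec elts :: "('i, 'p) name \<Rightarrow> (('i, 'p) name \<times> 'p) set" where
  "elts (Name f) = ran f"

definition elt_rel :: "(('i, 'p) name \<times> ('i, 'p) name) set" where
  "elt_rel = {(y, x). \<exists>r. (y, r) \<in> elts x}"

lemma wf_elt_rel: "wf elt_rel"
proof (rule wfUNIVI)
  fix P :: "('i, 'p) name \<Rightarrow> bool" and x :: "('i, 'p) name"
  assume *: "\<forall>x. (\<forall>y. (y, x) \<in> elt_rel \<longrightarrow> P y) \<longrightarrow> P x"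
  show "P x"
  proof (induction x)
    case (Name f)
    have "P y" if "(y, r) \<in> ran f" for y r
    proof -
      from that obtain i where "f i = Some (y, r)" by (auto simp: ran_def)
      then show ?thesis
        by (intro Name.IH[of "Some (y, r)" "(y, r)" y]) (auto intro: range_eqI[of _ _ i] simp: fsts.simps)
    qed
    then show ?case using *[rule_format, of "Name f"] by (auto simp: elt_rel_def)
  qed
qed

text \<open>The hereditary condition that all conditions occurring in a name belong to \<open>P\<close>.\<close>

inductive is_name :: "'p set \<Rightarrow> ('i, 'p) name \<Rightarrow> bool" for P where
  "(\<And>y r. (y, r) \<in> elts x \<Longrightarrow> r \<in> P \<and> is_name P y) \<Longrightarrow> is_name P x"

text \<open>A forcing notion is a set \<open>P\<close> of conditions in a preordered type, smaller conditions being
  stronger. A statement of the forcing language is identified with the predicate ``the condition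
  \<open>p\<close> forces it''.\<close>

definition dense_below :: "'p::preorder set \<Rightarrow> 'p \<Rightarrow> ('p \<Rightarrow> bool) \<Rightarrow> bool" where
  "dense_below P p D \<longleftrightarrow> (\<forall>q\<in>P. q \<le> p \<longrightarrow> (\<exists>r\<in>P. r \<le> q \<and> D r))"

lemma dense_below_cong [fundef_cong]:
  assumes "P = P'" "p = p'" "\<And>r. r \<in> P' \<Longrightarrow> r \<le> p' \<Longrightarrow> D r = D' r"
  shows "dense_below P p D = dense_below P' p' D'"
  using assms unfolding dense_below_def by (meson order_trans)

text \<open>Equality of names by mutual inclusion: \<open>p\<close> forces \<open>x \<subseteq> y\<close> iff every \<open>q \<le> p\<close> with \<open>q \<le> r\<close>
  forces \<open>c \<in> y\<close>, for all \<open>(c, r)\<close> in \<open>x\<close>. The clause for membership is inlined to make this a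
  recursion on equality alone; the usual mutually recursive form is \<open>forces_eq_iff\<close> below.\<close>

function forces_eq :: "'p::preorder set \<Rightarrow> ('i, 'p) name \<Rightarrow> ('i, 'p) name \<Rightarrow> 'p \<Rightarrow> bool" where
  "forces_eq P x y p \<longleftrightarrow>
     (\<forall>(c, r)\<in>elts x. \<forall>q\<in>P. q \<le> p \<and> q \<le> r \<longrightarrow>
        dense_below P q (\<lambda>s. \<exists>(d, u)\<in>elts y. s \<le> u \<and> forces_eq P c d s)) \<and>
     (\<forall>(d, u)\<in>elts y. \<forall>q\<in>P. q \<le> p \<and> q \<le> u \<longrightarrow>
        dense_below P q (\<lambda>s. \<exists>(c, r)\<in>elts x. s \<le> r \<and> forces_eq P c d s))"
  by pat_completeness auto
termination
proof (relation "inv_image elt_rel (\<lambda>(P, x, y, p). x)")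
qed (rule wf_inv_image wf_elt_rel | auto simp: elt_rel_def)+

declare forces_eq.simps [simp del]

definition forces_mem :: "'p::preorder set \<Rightarrow> ('i, 'p) name \<Rightarrow> ('i, 'p) name \<Rightarrow> 'p \<Rightarrow> bool" where
  "forces_mem P x y p \<longleftrightarrow> dense_below P p (\<lambda>s. \<exists>(d, u)\<in>elts y. s \<le> u \<and> forces_eq P x d s)"

lemma forces_eq_sym: "forces_eq P x y p \<longleftrightarrow> forces_eq P y x p"
proof (induction x arbitrary: y p rule: wf_induct_rule[OF wf_elt_rel])
  case (1 x)
  have sym: "forces_eq P c d s \<longleftrightarrow> forces_eq P d c s" if "(c, r) \<in> elts x" for c r d s
    using 1[of c] that by (auto simp: elt_rel_def)
  have mem: "(\<exists>(c, r)\<in>elts x. s \<le> r \<and> forces_eq P c d s) \<longleftrightarrow>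
             (\<exists>(c, r)\<in>elts x. s \<le> r \<and> forces_eq P d c s)" for d s
    using sym by blast
  have sub: "dense_below P q (\<lambda>s. \<exists>(d, u)\<in>elts y. s \<le> u \<and> forces_eq P c d s) \<longleftrightarrow>
             dense_below P q (\<lambda>s. \<exists>(d, u)\<in>elts y. s \<le> u \<and> forces_eq P d c s)"
    if "(c, r) \<in> elts x" for c r q
    using sym[OF that] by presburger
  show ?case
    unfolding forces_eq.simps[of P x y] forces_eq.simps[of P y x] mem
    using sub by fast
qed

lemma forces_eq_iff:
  "forces_eq P x y p \<longleftrightarrow>
     (\<forall>(c, r)\<in>elts x. \<forall>q\<in>P. q \<le> p \<and> q \<le> r \<longrightarrow> forces_mem P c y q) \<and>
     (\<forall>(d, u)\<in>elts y. \<forall>q\<in>P. q \<le> p \<and> q \<le> u \<longrightarrow> forces_mem P d x q)"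
proof -
  have "(\<lambda>s. \<exists>(c, r)\<in>elts x. s \<le> r \<and> forces_eq P c d s) =
        (\<lambda>s. \<exists>(c, r)\<in>elts x. s \<le> r \<and> forces_eq P d c s)" for d
    by (simp only: forces_eq_sym[of P _ d])
  then show ?thesis
    unfolding forces_mem_def forces_eq.simps[of P x y] by simp
qed

definition forces_not :: "'p::preorder set \<Rightarrow> ('p \<Rightarrow> bool) \<Rightarrow> 'p \<Rightarrow> bool" where
  "forces_not P \<phi> p \<longleftrightarrow> (\<forall>q\<in>P. q \<le> p \<longrightarrow> \<not> \<phi> q)"

definition forces_and :: "('p \<Rightarrow> bool) \<Rightarrow> ('p \<Rightarrow> bool) \<Rightarrow> 'p \<Rightarrow> bool" where
  "forces_and \<phi> \<psi> p \<longleftrightarrow> \<phi> p \<and> \<psi> p"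

definition forces_imp :: "'p::preorder set \<Rightarrow> ('p \<Rightarrow> bool) \<Rightarrow> ('p \<Rightarrow> bool) \<Rightarrow> 'p \<Rightarrow> bool" where
  "forces_imp P \<phi> \<psi> p \<longleftrightarrow> (\<forall>q\<in>P. q \<le> p \<and> \<phi> q \<longrightarrow> \<psi> q)"

text \<open>The range \<open>A\<close> of a quantifier is either the class of names or a set \<open>A\<close> of the ground model; in
  the latter case this is quantification over the members of the check name of \<open>A\<close>.\<close>

definition forces_all :: "'a set \<Rightarrow> ('a \<Rightarrow> 'p \<Rightarrow> bool) \<Rightarrow> 'p \<Rightarrow> bool" where
  "forces_all A \<phi> p \<longleftrightarrow> (\<forall>a\<in>A. \<phi> a p)"

definition forces_ex :: "'p::preorder set \<Rightarrow> 'a set \<Rightarrow> ('a \<Rightarrow> 'p \<Rightarrow> bool) \<Rightarrow> 'p \<Rightarrow> bool" where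
  "forces_ex P A \<phi> p \<longleftrightarrow> dense_below P p (\<lambda>q. \<exists>a\<in>A. \<phi> a q)"


section \<open>Adding a Cohen \<open>\<kappa>\<close>-real\<close>

text \<open>The index type is large enough for the check names of ordinals below \<open>\<kappa>\<close>, for ordered pairs,
  and for a nice name \<open>\<subseteq> {(\<alpha>, i)\<check> | \<alpha> < \<kappa>, i < 2} \<times> P\<close> of every element of \<open>2\<^bsup>\<kappa>\<^esup>\<close> in an
  extension by \<open>P\<close>.\<close>

type_synonym ('k, 'p) kname = "('k \<times> bool \<times> 'p, 'p) name"

function ordinal_name :: "'p set \<Rightarrow> 'k::wellorder \<Rightarrow> ('k, 'p) kname" where
  "ordinal_name P \<alpha> =
     Name (\<lambda>(\<beta>, _, p). if \<beta> < \<alpha> \<and> p \<in> P then Some (ordinal_name P \<beta>, p) else None)"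
  by pat_completeness auto
termination
  by (relation "inv_image {(\<beta>, \<alpha>). \<beta> < \<alpha>} snd") (auto intro: wf_inv_image wf)

declare ordinal_name.simps [simp del]

definition upair_name :: "'p set \<Rightarrow> ('k, 'p) kname \<Rightarrow> ('k, 'p) kname \<Rightarrow> ('k, 'p) kname" where
  "upair_name P x y = Name (\<lambda>(_, i, p). if p \<in> P then Some (if i then x else y, p) else None)"

lemma elts_ordinal_name:
  "elts (ordinal_name P \<alpha>) = {(ordinal_name P \<beta>, p) | \<beta> p. \<beta> < \<alpha> \<and> p \<in> P}"
  by (subst ordinal_name.simps) (auto simp: ran_def split: if_splits)

lemma elts_upair_name: "elts (upair_name P x y) = {x, y} \<times> P"
  by (auto simp: upair_name_def ran_def split: if_splits)

definition pair_name :: "'p set \<Rightarrow> ('k, 'p) kname \<Rightarrow> ('k, 'p) kname \<Rightarrow> ('k, 'p) kname" where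
  "pair_name P x y = upair_name P (upair_name P x x) (upair_name P x y)"

text \<open>The ordinals \<open>0 = \<emptyset>\<close> and \<open>1 = {\<emptyset>}\<close>.\<close>

definition bit_name :: "'p set \<Rightarrow> bool \<Rightarrow> ('k, 'p) kname" where
  "bit_name P i = (let zero = Name (\<lambda>_. None) in if i then upair_name P zero zero else zero)"

text \<open>\<open>(\<alpha>, i) \<in> x\<close>, that is, \<open>x(\<alpha>) = i\<close> when \<open>x\<close> is a function.\<close>

definition forces_val ::
    "'p::preorder set \<Rightarrow> ('k::wellorder, 'p) kname \<Rightarrow> 'k \<Rightarrow> bool \<Rightarrow> 'p \<Rightarrow> bool" where
  "forces_val P x \<alpha> i = forces_mem P (pair_name P (ordinal_name P \<alpha>) (bit_name P i)) x"

text \<open>\<open>x \<in> 2\<^bsup>\<kappa>\<^esup>\<close>: \<open>x \<subseteq> \<kappa> \<times> 2\<close>, and \<open>x\<close> is total and single-valued.\<close>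

definition forces_in_2_kappa ::
    "'p::preorder set \<Rightarrow> ('k::wellorder, 'p) kname \<Rightarrow> 'p \<Rightarrow> bool" where
  "forces_in_2_kappa P x =
     forces_and
       (forces_all {y. is_name P y} (\<lambda>y. forces_imp P (forces_mem P y x)
          (forces_ex P UNIV (\<lambda>\<alpha>. forces_ex P UNIV (\<lambda>i.
             forces_eq P y (pair_name P (ordinal_name P \<alpha>) (bit_name P i)))))))
       (forces_and
          (forces_all UNIV (\<lambda>\<alpha>. forces_ex P UNIV (\<lambda>i. forces_val P x \<alpha> i)))
          (forces_all UNIV (\<lambda>\<alpha>. forces_not P
             (forces_and (forces_val P x \<alpha> False) (forces_val P x \<alpha> True)))))"

text \<open>Dense subsets, in the ground model, of \<open>2\<^bsup><\<kappa>\<^esup>\<close> ordered by end-extension.\<close>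

definition Cohen_dense :: "('k::wellorder \<rightharpoonup> bool) set set" where
  "Cohen_dense = {D. D \<subseteq> seqs \<and> (\<forall>s\<in>seqs. \<exists>t\<in>D. s \<subseteq>\<^sub>m t)}"

text \<open>\<open>x\<close> is generic over the ground model: for every dense \<open>D\<close> of the ground model there is
  \<open>t \<in> D\<close> with \<open>t \<subseteq> x\<close>. (The initial segments of \<open>x\<close> always form a filter.)\<close>

definition forces_Cohen_generic ::
    "'p::preorder set \<Rightarrow> ('k::wellorder, 'p) kname \<Rightarrow> 'p \<Rightarrow> bool" where
  "forces_Cohen_generic P x =
     forces_all Cohen_dense (\<lambda>D. forces_ex P D (\<lambda>t.
       forces_all (Map.graph t) (\<lambda>(\<alpha>, i). forces_val P x \<alpha> i)))"

text \<open>Every generic extension contains a Cohen \<open>\<kappa>\<close>-real, that is, every condition forces that there is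
  one.\<close>

definition adds_Cohen_real :: "'k::wellorder itself \<Rightarrow> 'p::preorder set \<Rightarrow> bool" where
  "adds_Cohen_real _ P \<longleftrightarrow>
     (\<forall>p\<in>P. forces_ex P {x :: ('k, 'p) kname. is_name P x}
        (\<lambda>x. forces_and (forces_in_2_kappa P x) (forces_Cohen_generic P x)) p)"

end

theory Submission
  imports Defs
begin

text \<open>Split the ordinals below \<open>\<kappa>\<close> of cofinality \<open>\<omega>\<close> into two stationary sets \<open>S\<close> and \<open>- S\<close>. From the
  generic branch \<open>g\<close> read off \<open>x \<in> 2\<^sup>\<kappa>\<close> by \<open>x(\<alpha>) = 1\<close> iff \<open>sup (g ` \<omega>(\<alpha> + 1)) \<in> S\<close>. If \<open>\<sigma>\<close> is a node above
  the stem of a Laver tree \<open>T\<close>, then the \<open>\<delta>\<close> below which every node of \<open>T\<close> finitely many levels above \<open>\<sigma>\<close>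
  with new values below \<open>\<delta>\<close> has unboundedly many successors form a club, so there are \<open>\<omega>\<close>-extensions of \<open>\<sigma>\<close> in
  \<open>T\<close> with supremum in \<open>S\<close> and others with supremum in \<open>- S\<close>. As \<open>T\<close> is limit-closed, all bits beyond the
  stem can be prescribed one after the other, so any dense subset of \<open>2\<^bsup><\<kappa>\<^esup>\<close> is met by passing to
  some \<open>T \<up> \<tau>\<close>.\<close>

section \<open>Bounded sets and closure points below \<open>\<kappa>\<close>\<close>

definition next_ordinal :: "'k::wellorder \<Rightarrow> 'k" where
  "next_ordinal \<alpha> = (LEAST \<beta>. \<alpha> < \<beta>)"

definition omega_limit :: "(nat \<Rightarrow> 'k::wellorder) \<Rightarrow> 'k \<Rightarrow> bool" where
  "omega_limit c \<delta> \<longleftrightarrow> (\<forall>n. c n < \<delta>) \<and> (\<forall>\<eta><\<delta>. \<exists>n. \<eta> < c n)"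

lemma omega_limitD:
  assumes "omega_limit c \<delta>"
  shows omega_limit_less: "c n < \<delta>" and omega_limit_cofinal: "\<eta> < \<delta> \<Longrightarrow> \<exists>n. \<eta> < c n"
  using assms by (auto simp: omega_limit_def)

text \<open>The sets of closure points of functions generate the club filter, so this says that \<open>A\<close> meets
  \<open>cof(\<omega>)\<close> in a stationary set.\<close>

definition stationary_cof_omega :: "'k::wellorder set \<Rightarrow> bool" where
  "stationary_cof_omega A \<longleftrightarrow>
     (\<forall>h. \<exists>\<delta>\<in>A. (\<exists>c. omega_limit c \<delta>) \<and> (\<forall>\<alpha><\<delta>. h \<alpha> < \<delta>))"

locale regular_uncountable =
  fixes k :: "'k::wellorder itself"
  assumes Card_order_kappa: "Card_order (kappa :: 'k rel)"
    and regularCard_kappa: "regularCard (kappa :: 'k rel)"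
    and natLeq_less_kappa: "natLeq <o (kappa :: 'k rel)"
begin

section \<open>Bounds from regularity and uncountability\<close>

lemma Field_kappa: "Field (kappa :: 'k rel) = UNIV"
  by (auto simp: kappa_def Field_def)

lemma card_lessThan_less_kappa: "|{..<\<alpha>::'k}| <o (kappa :: 'k rel)"
proof -
  have "underS kappa \<alpha> = {..<\<alpha>}"
    by (auto simp: underS_def kappa_def)
  then show ?thesis
    using card_of_underS[OF Card_order_kappa, of \<alpha>] by (simp add: Field_kappa)
qed

lemma infinite_UNIV_kappa: "infinite (UNIV :: 'k set)"
proof -
  have "natLeq \<le>o |UNIV :: 'k set|"
    using natLeq_less_kappa card_of_Field_ordIso[OF Card_order_kappa] Field_kappa
    by (metis ordLess_imp_ordLeq ordLeq_ordIso_trans ordIso_symmetric)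
  then show ?thesis
    using infinite_iff_natLeq_ordLeq by blast
qed

lemma ex_greater: "\<exists>\<beta>. (\<alpha> :: 'k) < \<beta>"
  using infinite_Card_order_limit[OF Card_order_kappa, of \<alpha>] infinite_UNIV_kappa
  by (auto simp: Field_kappa) (auto simp: kappa_def less_le)

text \<open>By regularity fewer than \<kappa> ordinals are not cofinal; \<open>ex_greater\<close>
  turns the resulting weak bound into a strict one.\<close>

lemma bounded_image:
  assumes "|A| <o (kappa :: 'k rel)"
  shows "\<exists>b::'k. \<forall>a\<in>A. f a < b"
proof -
  have "|f ` A| <o (kappa :: 'k rel)"
    using assms card_of_image ordLeq_ordLess_trans by blast
  then have "\<not> cofinal (f ` A) (kappa :: 'k rel)"
    using regularCard_kappa not_ordLess_ordIso unfolding regularCard_def Field_kappa by blast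
  then obtain a where a: "\<And>b. b \<in> f ` A \<Longrightarrow> b \<le> a"
    unfolding cofinal_def Field_kappa kappa_def by fastforce
  obtain b where "a < b" using ex_greater by blast
  then show ?thesis using a by (meson imageI le_less_trans)
qed

lemma bounded_lessThan: "\<exists>b::'k. \<forall>a<\<alpha>::'k. f a < b"
  using bounded_image[OF card_lessThan_less_kappa, of \<alpha> f] by auto

lemma bounded_atMost: "\<exists>b::'k. \<forall>a\<le>\<alpha>::'k. f a < b"
proof -
  obtain \<beta> where "\<alpha> < \<beta>" using ex_greater by blast
  then show ?thesis using bounded_lessThan[of \<beta> f] by (meson le_less_trans)
qed

text \<open>Uncountability together with regularity rules out cofinality \<omega> for \<kappa>, so
  countably many bounds merge into one.\<close>

lemma bounded_nat: "\<exists>b::'k. \<forall>n::nat. f n < b"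
proof -
  have "|UNIV :: nat set| <o (kappa :: 'k rel)"
    using card_of_nat natLeq_less_kappa ordIso_ordLess_trans by blast
  from bounded_image[OF this, of f] show ?thesis by auto
qed

text \<open>A bounded set lies in some \<open>{..<b}\<close>, which has fewer than \<kappa>
  elements.\<close>

lemma unbounded_of_card:
  assumes "|A| =o (kappa :: 'k rel)"
  shows "\<exists>\<beta>\<in>A. (m::'k) < \<beta>"
proof (rule ccontr)
  assume *: "\<not> ?thesis"
  obtain b where "m < b" using ex_greater by blast
  with * have "A \<subseteq> {..<b}" by force
  then have "|A| <o (kappa :: 'k rel)"
    using card_lessThan_less_kappa card_of_mono1 ordLeq_ordLess_trans by blast
  with assms show False using not_ordLess_ordIso by blast
qed

section \<open>Successors and limits of cofinality \<omega>\<close>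

lemma less_next_ordinal: "(\<alpha>::'k) < next_ordinal \<alpha>"
  unfolding next_ordinal_def using ex_greater by (rule LeastI_ex)

lemma next_ordinal_le: "(\<alpha>::'k) < \<beta> \<Longrightarrow> next_ordinal \<alpha> \<le> \<beta>"
  unfolding next_ordinal_def by (rule Least_le)

lemma less_next_ordinal_iff: "\<beta> < next_ordinal \<alpha> \<longleftrightarrow> (\<beta>::'k) \<le> \<alpha>"
  using less_next_ordinal next_ordinal_le by (meson leD le_less_trans not_le)

text \<open>The least strict upper bound works: an \<eta> below it is reached by some
  \<open>c n\<close> and passed by \<open>c (Suc n)\<close>.\<close>

lemma ex_omega_limit_of_strict_mono:
  assumes "\<And>n. (c n :: 'k) < c (Suc n)"
  shows "\<exists>\<delta>. omega_limit c \<delta>"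
proof -
  define \<delta> where "\<delta> = (LEAST b. \<forall>n. c n < b)"
  have "\<forall>n. c n < \<delta>"
    unfolding \<delta>_def using bounded_nat by (rule LeastI_ex)
  moreover have "\<exists>n. \<eta> < c n" if "\<eta> < \<delta>" for \<eta>
    using not_less_Least[OF that[unfolded \<delta>_def]] assms by (meson le_less_trans not_less)
  ultimately show ?thesis unfolding omega_limit_def by auto
qed

lemma omega_limit_imp_limit_ordinal: "omega_limit c (\<delta>::'k) \<Longrightarrow> limit_ordinal \<delta>"
  using omega_limitD unfolding limit_ordinal_def by metis

lemma limit_ordinal_next_ordinal_less:
  "limit_ordinal \<delta> \<Longrightarrow> \<alpha> < \<delta> \<Longrightarrow> next_ordinal (\<alpha>::'k) < \<delta>"
  unfolding limit_ordinal_def by (meson le_less_trans next_ordinal_le)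

lemma ex_limit_ordinal_greater: "\<exists>\<delta>. limit_ordinal \<delta> \<and> (\<alpha>::'k) < \<delta>"
proof -
  obtain \<delta> where \<delta>: "omega_limit (\<lambda>n. (next_ordinal ^^ n) \<alpha>) \<delta>"
    using ex_omega_limit_of_strict_mono[of "\<lambda>n. (next_ordinal ^^ n) \<alpha>"] less_next_ordinal
    by auto
  have "\<alpha> < \<delta>" using omega_limit_less[OF \<delta>, of 0] by simp
  then show ?thesis using omega_limit_imp_limit_ordinal[OF \<delta>] by blast
qed

text \<open>Here \<open>L\<close> is \<mu> + \<omega>. The iterated successors converge to a limit
  ordinal, which is at least \<open>L\<close> by leastness, and they cannot leave the limit
  \<open>L\<close>.\<close>

lemma omega_limit_least_limit:
  fixes \<mu> L :: 'k
  assumes "limit_ordinal L" "\<mu> < L" and least: "\<And>l. limit_ordinal l \<Longrightarrow> \<mu> < l \<Longrightarrow> L \<le> l"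
  shows "omega_limit (\<lambda>n. (next_ordinal ^^ n) \<mu>) L"
proof -
  obtain \<delta> where \<delta>: "omega_limit (\<lambda>n. (next_ordinal ^^ n) \<mu>) \<delta>"
    using ex_omega_limit_of_strict_mono[of "\<lambda>n. (next_ordinal ^^ n) \<mu>"] less_next_ordinal
    by auto
  have "\<mu> < \<delta>" using omega_limit_less[OF \<delta>, of 0] by simp
  then have "L \<le> \<delta>" using least omega_limit_imp_limit_ordinal[OF \<delta>] by blast
  moreover have "(next_ordinal ^^ n) \<mu> < L" for n
    using assms by (induction n) (auto intro: limit_ordinal_next_ordinal_less)
  ultimately show ?thesis
    using omega_limit_cofinal[OF \<delta>] unfolding omega_limit_def by (meson less_le_trans)
qed

text \<open>Iterate a \<open>g\<close> that dominates \<open>h\<close> on initial segments: any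
  \<alpha> below the supremum is below some \<open>c n\<close>, hence \<open>h \<alpha>\<close> is
  below \<open>c (Suc n)\<close>.\<close>

lemma ex_closure_point:
  fixes h :: "'k \<Rightarrow> 'k"
  shows "\<exists>\<delta>. (\<exists>c. omega_limit c \<delta>) \<and> (\<forall>\<alpha><\<delta>. h \<alpha> < \<delta>)"
proof -
  have "\<exists>b. \<alpha> < b \<and> (\<forall>\<beta>\<le>\<alpha>. h \<beta> < b)" for \<alpha>
    using bounded_atMost[of \<alpha> "\<lambda>\<beta>. max \<alpha> (h \<beta>)"] by auto
  then obtain g where g: "\<And>\<alpha>. \<alpha> < g \<alpha>" "\<And>\<alpha> \<beta>. \<beta> \<le> \<alpha> \<Longrightarrow> h \<beta> < g \<alpha>"
    by metis
  \<comment> \<open>The starting point is arbitrary.\<close>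
  define c where "c n = (g ^^ n) undefined" for n
  have c_Suc: "c (Suc n) = g (c n)" for n by (simp add: c_def)
  have "c n < c (Suc n)" for n unfolding c_Suc by (rule g(1))
  from ex_omega_limit_of_strict_mono[of c, OF this] obtain \<delta> where \<delta>: "omega_limit c \<delta>" ..
  have "h \<alpha> < \<delta>" if "\<alpha> < \<delta>" for \<alpha>
  proof -
    obtain n where "\<alpha> < c n" using omega_limit_cofinal[OF \<delta> \<open>\<alpha> < \<delta>\<close>] ..
    then have "h \<alpha> < c (Suc n)" using g(2)[of \<alpha> "c n"] by (simp add: c_Suc)
    then show ?thesis using omega_limit_less[OF \<delta>] by (rule less_trans)
  qed
  with \<delta> show ?thesis by blast
qed

text \<open>Fix a cofinal \<open>a \<delta> : \<omega> \<rightarrow> \<delta>\<close> for each \<open>\<delta>\<close> of cofinality \<open>\<omega>\<close>. Some set \<open>{\<delta>. \<eta> \<le> a \<delta> n}\<close> splits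
  \<open>cof(\<omega>)\<close>: otherwise either every \<open>a _ n\<close> is bounded on a club, which is impossible beyond the supremum
  of these bounds, or some \<open>a _ n\<close> is above each \<open>\<eta>\<close> on a club, which contradicts \<open>a \<delta> n < \<delta>\<close> on the
  diagonal intersection.\<close>

lemma ex_stationary_split:
  "\<exists>S::'k set. stationary_cof_omega S \<and> stationary_cof_omega (- S)"
proof -
  define a where "a \<delta> = (SOME c. omega_limit c (\<delta>::'k))" for \<delta>
  have a: "omega_limit (a \<delta>) \<delta>" if "omega_limit c \<delta>" for c \<delta>
    unfolding a_def using that by (rule someI[of "\<lambda>c. omega_limit c \<delta>"])
  \<comment> \<open>Where \<delta> does not have cofinality \<omega>, \<open>a \<delta>\<close> is
    arbitrary; this is harmless because \<open>stationary_cof_omega\<close> looks only at cofinality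
    \<omega>.\<close>
  define S where "S n \<eta> = {\<delta>::'k. \<eta> \<le> a \<delta> n}" for n \<eta>
  have "\<exists>n. \<forall>\<eta>. stationary_cof_omega (S n \<eta>)"
  proof (rule ccontr)
    assume "\<not> ?thesis"
    then have "\<forall>n. \<exists>\<eta> h. \<forall>\<delta>\<in>S n \<eta>. \<not> ((\<exists>c. omega_limit c \<delta>) \<and> (\<forall>\<alpha><\<delta>. h \<alpha> < \<delta>))"
      unfolding stationary_cof_omega_def by blast
    then obtain \<eta> h where h:
      "\<And>n \<delta> c. omega_limit c \<delta> \<Longrightarrow> (\<And>\<alpha>. \<alpha> < \<delta> \<Longrightarrow> h n \<alpha> < \<delta>) \<Longrightarrow> \<delta> \<notin> S n (\<eta> n)"
      by metis
    obtain b where b: "\<And>n. \<eta> n < b" using bounded_nat[of \<eta>] by blast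
    have "\<forall>\<alpha>. \<exists>g. \<forall>n. h n \<alpha> < g" by (intro allI bounded_nat)
    then obtain g where g: "\<And>\<alpha> n. h n \<alpha> < g \<alpha>" by metis
    obtain \<delta> c where \<delta>: "omega_limit c \<delta>" "\<And>\<alpha>. \<alpha> < \<delta> \<Longrightarrow> max (g \<alpha>) b < \<delta>"
      using ex_closure_point[of "\<lambda>\<alpha>. max (g \<alpha>) b"] by blast
    have "b < \<delta>" using \<delta>(2)[OF omega_limit_less[OF \<delta>(1)]] by simp
    moreover have "a \<delta> n < b" for n
    proof -
      have "\<delta> \<notin> S n (\<eta> n)" using h[OF \<delta>(1)] \<delta>(2) g by (meson less_trans max_less_iff_conj)
      then show ?thesis using b[of n] by (auto simp: S_def)
    qed
    ultimately show False using omega_limit_cofinal[OF a[OF \<delta>(1)]] by (meson less_asym)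
  qed
  then obtain n where n: "\<And>\<eta>. stationary_cof_omega (S n \<eta>)" by blast
  have "\<exists>\<eta>. stationary_cof_omega (- S n \<eta>)"
  proof (rule ccontr)
    assume "\<not> ?thesis"
    then have "\<forall>\<eta>. \<exists>h. \<forall>\<delta>\<in>- S n \<eta>. \<not> ((\<exists>c. omega_limit c \<delta>) \<and> (\<forall>\<alpha><\<delta>. h \<alpha> < \<delta>))"
      unfolding stationary_cof_omega_def by blast
    then obtain h where h:
      "\<And>\<eta> \<delta> c. omega_limit c \<delta> \<Longrightarrow> (\<And>\<alpha>. \<alpha> < \<delta> \<Longrightarrow> h \<eta> \<alpha> < \<delta>) \<Longrightarrow> \<delta> \<in> S n \<eta>"
      by (metis ComplI)
    \<comment> \<open>Bounding the whole square of indices lets closure under a single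
      \<open>g\<close> put \<delta> into the diagonal intersection.\<close>
    have "\<exists>g. \<forall>\<eta>\<le>\<alpha>. \<forall>\<beta>\<le>\<alpha>. h \<eta> \<beta> < g" for \<alpha>
    proof -
      have "\<forall>\<eta>. \<exists>g. \<forall>\<beta>\<le>\<alpha>. h \<eta> \<beta> < g" by (intro allI bounded_atMost)
      then obtain g where "\<And>\<eta> \<beta>. \<beta> \<le> \<alpha> \<Longrightarrow> h \<eta> \<beta> < g \<eta>" by metis
      moreover obtain G where "\<And>\<eta>. \<eta> \<le> \<alpha> \<Longrightarrow> g \<eta> < G" using bounded_atMost[of \<alpha> g] by blast
      ultimately show ?thesis by (meson less_trans)
    qed
    then obtain g where g: "\<And>\<alpha> \<eta> \<beta>. \<eta> \<le> \<alpha> \<Longrightarrow> \<beta> \<le> \<alpha> \<Longrightarrow> h \<eta> \<beta> < g \<alpha>" by metis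
    obtain \<delta> c where \<delta>: "omega_limit c \<delta>" "\<And>\<alpha>. \<alpha> < \<delta> \<Longrightarrow> g \<alpha> < \<delta>"
      using ex_closure_point[of g] by blast
    have "\<eta> \<le> a \<delta> n" if "\<eta> < \<delta>" for \<eta>
    proof -
      have "h \<eta> \<alpha> < \<delta>" if "\<alpha> < \<delta>" for \<alpha>
        using g[of \<eta> "max \<eta> \<alpha>" \<alpha>] \<delta>(2)[of "max \<eta> \<alpha>"] \<open>\<eta> < \<delta>\<close> that by fastforce
      then have "\<delta> \<in> S n \<eta>" using h[OF \<delta>(1)] by blast
      then show ?thesis by (simp add: S_def)
    qed
    moreover obtain \<eta> where "a \<delta> n < \<eta>" "\<eta> < \<delta>"
      using omega_limit_cofinal[OF \<delta>(1) omega_limit_less[OF a[OF \<delta>(1)]]] omega_limit_less[OF \<delta>(1)]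
      by blast
    ultimately show False by (meson leD)
  qed
  with n show ?thesis by blast
qed

end


section \<open>Blocks of length \<open>\<omega>\<close>\<close>

text \<open>\<open>block_end \<alpha>\<close> is \<open>\<omega> \<cdot> (\<alpha> + 1)\<close>, and \<open>block_start \<alpha>\<close> is \<open>\<omega> \<cdot> \<alpha>\<close>.\<close>

function block_end :: "'k::wellorder \<Rightarrow> 'k" where
  "block_end \<alpha> = (LEAST l. limit_ordinal l \<and> (\<exists>\<gamma><l. \<forall>\<beta>. \<beta> < \<alpha> \<longrightarrow> block_end \<beta> \<le> \<gamma>))"
  by pat_completeness auto
termination
  by (relation "{(\<beta>, \<alpha>). \<beta> < \<alpha>}") (auto intro: wf)

declare block_end.simps [simp del]

definition block_start :: "'k::wellorder \<Rightarrow> 'k" where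
  "block_start \<alpha> = (LEAST \<gamma>. \<forall>\<beta><\<alpha>. block_end \<beta> \<le> \<gamma>)"

text \<open>The least strict upper bound of all values before the end of the block; it is the
  supremum when that is not attained. Undefined places make \<open>the\<close> arbitrary, so the bit
  is meaningful only when \<tau> covers the block.\<close>

definition block_bit :: "'k set \<Rightarrow> ('k::wellorder \<rightharpoonup> 'k) \<Rightarrow> 'k \<Rightarrow> bool" where
  "block_bit S \<tau> \<alpha> \<longleftrightarrow> (LEAST \<delta>. \<forall>\<gamma><block_end \<alpha>. the (\<tau> \<gamma>) < \<delta>) \<in> S"

lemma block_bit_cong:
  assumes "\<And>\<gamma>. \<gamma> < block_end \<alpha> \<Longrightarrow> \<tau> \<gamma> = \<tau>' \<gamma>"
  shows "block_bit S \<tau> \<alpha> = block_bit S \<tau>' \<alpha>"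
proof -
  have "(\<forall>\<gamma><block_end \<alpha>. the (\<tau> \<gamma>) < \<delta>) \<longleftrightarrow> (\<forall>\<gamma><block_end \<alpha>. the (\<tau>' \<gamma>) < \<delta>)" for \<delta>
    using assms by auto
  then show ?thesis by (simp add: block_bit_def)
qed

lemma block_bit_mono:
  assumes "\<tau> \<subseteq>\<^sub>m \<tau>'" "{..<block_end \<alpha>} \<subseteq> dom \<tau>"
  shows "block_bit S \<tau>' \<alpha> = block_bit S \<tau> \<alpha>"
  using assms by (intro block_bit_cong) (metis lessThan_iff map_le_def subsetD)

context regular_uncountable
begin

text \<open>Regularity bounds \<open>block_end\<close> below \<alpha>, so the minimum in
  \<open>block_start\<close> is attained.\<close>

lemma
  shows block_end_le_block_start: "\<beta> < \<alpha> \<Longrightarrow> block_end \<beta> \<le> block_start (\<alpha>::'k)"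
    and less_block_startD: "\<gamma> < block_start \<alpha> \<Longrightarrow> \<exists>\<beta><\<alpha>. \<gamma> < block_end (\<beta>::'k)"
    and limit_block_end: "limit_ordinal (block_end (\<alpha>::'k))"
    and block_start_less_block_end: "block_start \<alpha> < block_end (\<alpha>::'k)"
    and block_end_least: "limit_ordinal l \<Longrightarrow> block_start \<alpha> < l \<Longrightarrow> block_end (\<alpha>::'k) \<le> l"
proof -
  obtain b where b: "\<forall>\<beta><\<alpha>. block_end \<beta> < b"
    using bounded_lessThan[of \<alpha> block_end] by blast
  then have "\<forall>\<beta><\<alpha>. block_end \<beta> \<le> b" by auto
  then have start: "\<forall>\<beta><\<alpha>. block_end \<beta> \<le> block_start \<alpha>"
    unfolding block_start_def by (rule LeastI)
  then show "\<beta> < \<alpha> \<Longrightarrow> block_end \<beta> \<le> block_start \<alpha>" by blast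
  show "\<exists>\<beta><\<alpha>. \<gamma> < block_end \<beta>" if "\<gamma> < block_start \<alpha>"
    using not_less_Least[OF that[unfolded block_start_def]] by (meson not_le)
  \<comment> \<open>The recursion thus makes \<open>block_end \<alpha>\<close> the first limit
    ordinal beyond \<open>block_start \<alpha>\<close>.\<close>
  have "(\<exists>\<gamma><l. \<forall>\<beta><\<alpha>. block_end \<beta> \<le> \<gamma>) \<longleftrightarrow> block_start \<alpha> < l" for l
    using start Least_le[of "\<lambda>\<gamma>. \<forall>\<beta><\<alpha>. block_end \<beta> \<le> \<gamma>"] unfolding block_start_def
    by (meson le_less_trans)
  then have E: "block_end \<alpha> = (LEAST l. limit_ordinal l \<and> block_start \<alpha> < l)"
    by (subst block_end.simps) simp
  have "limit_ordinal (block_end \<alpha>) \<and> block_start \<alpha> < block_end \<alpha>"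
    unfolding E by (rule LeastI_ex) (rule ex_limit_ordinal_greater)
  then show "limit_ordinal (block_end \<alpha>)" "block_start \<alpha> < block_end \<alpha>" by auto
  show "block_end \<alpha> \<le> l" if "limit_ordinal l" "block_start \<alpha> < l"
    unfolding E using that by (auto intro: Least_le)
qed

lemma block_end_strict_mono: "\<beta> < \<alpha> \<Longrightarrow> block_end \<beta> < block_end (\<alpha>::'k)"
  using block_end_le_block_start block_start_less_block_end by (rule le_less_trans)

text \<open>A strictly increasing function on ordinals dominates the identity; hence some block ends
  beyond any given stem.\<close>

lemma le_block_end: "\<alpha> \<le> block_end (\<alpha>::'k)"
proof (induction \<alpha> rule: less_induct)
  case (less \<alpha>)
  then show ?case using block_end_strict_mono by (meson leD not_le)
qed

end


section \<open>Nodes of Laver trees with prescribed bits\<close>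

text \<open>The restrictions of \<open>u\<close> form the chain that \<open>limit_closed\<close>
  asks for; as \<delta> is a limit, their union is all of \<open>u\<close>.\<close>

lemma limit_closed_restrict:
  assumes "tree T" "limit_closed T" "limit_ordinal \<delta>" "dom u = {..<\<delta>}"
    and "\<And>\<alpha>. \<alpha> < \<delta> \<Longrightarrow> u |` {..<\<alpha>} \<in> T"
  shows "u \<in> T"
proof -
  have "Map.graph u = (\<Union>\<alpha>\<in>{..<\<delta>}. Map.graph (u |` {..<\<alpha>}))"
  proof (intro set_eqI iffI)
    fix z assume z: "z \<in> Map.graph u"
    then have "fst z < \<delta>" using assms(4) by (auto simp: Map.graph_def)
    then obtain \<beta> where "\<beta> < \<delta>" "fst z < \<beta>" using assms(3) unfolding limit_ordinal_def by blast
    then show "z \<in> (\<Union>\<alpha>\<in>{..<\<delta>}. Map.graph (u |` {..<\<alpha>}))"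
      using z by (auto simp: Map.graph_def restrict_map_def intro!: bexI[of _ \<beta>])
  qed (auto simp: Map.graph_def restrict_map_def split: if_splits)
  moreover have "\<forall>\<alpha> \<beta>. \<alpha> < \<beta> \<and> \<beta> < \<delta> \<longrightarrow> (u |` {..<\<alpha>}) \<subseteq>\<^sub>m (u |` {..<\<beta>})"
    by (auto simp: map_le_def restrict_map_def)
  ultimately show ?thesis
    using assms(2)[unfolded limit_closed_def, THEN spec[of _ \<delta>], THEN spec[of _ "\<lambda>\<alpha>. u |` {..<\<alpha>}"],
        THEN spec[of _ u]] assms(3,5)
    by simp
qed

lemma tree_restrict:
  assumes "tree T" "\<sigma> \<in> T" "{..<\<alpha>} \<subseteq> dom \<sigma>"
  shows "\<sigma> |` {..<\<alpha>} \<in> T"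
proof -
  have "\<sigma> |` {..<\<alpha>} \<in> seqs" using assms(3) by (auto simp: seqs_def)
  moreover have "\<sigma> |` {..<\<alpha>} \<subseteq>\<^sub>m \<sigma>" by (auto simp: map_le_def)
  ultimately show ?thesis using assms(1,2) unfolding tree_def by blast
qed

text \<open>Comparability makes the choice of index irrelevant, so the maps glue together.\<close>

lemma ex_union:
  fixes f :: "'i \<Rightarrow> 'a \<rightharpoonup> 'b"
  assumes "\<And>i j. i \<in> I \<Longrightarrow> j \<in> I \<Longrightarrow> f i \<subseteq>\<^sub>m f j \<or> f j \<subseteq>\<^sub>m f i"
  shows "\<exists>u. dom u = (\<Union>i\<in>I. dom (f i)) \<and> (\<forall>i\<in>I. f i \<subseteq>\<^sub>m u)"
proof -
  define u where "u x = (if \<exists>i\<in>I. x \<in> dom (f i) then f (SOME i. i \<in> I \<and> x \<in> dom (f i)) x else None)"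
    for x
  have u: "u x = f i x" if "i \<in> I" "x \<in> dom (f i)" for i x
  proof -
    define j where "j = (SOME i. i \<in> I \<and> x \<in> dom (f i))"
    have "j \<in> I \<and> x \<in> dom (f j)" unfolding j_def using that by (intro someI) blast
    then have "f j x = f i x" using assms[of i j] that unfolding map_le_def by metis
    moreover have "u x = f j x" unfolding u_def j_def using that by auto
    ultimately show ?thesis by simp
  qed
  have "dom u = (\<Union>i\<in>I. dom (f i))"
  proof (intro set_eqI iffI)
    fix x assume "x \<in> dom u"
    then show "x \<in> (\<Union>i\<in>I. dom (f i))" by (auto simp: u_def split: if_splits)
  next
    fix x assume "x \<in> (\<Union>i\<in>I. dom (f i))"
    then show "x \<in> dom u" using u by fastforce
  qed
  moreover have "\<forall>i\<in>I. f i \<subseteq>\<^sub>m u" using u by (auto simp: map_le_def)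
  ultimately show ?thesis by blast
qed

text \<open>The stem of a Laver tree, of length \<theta>, is to be substituted for
  \<open>s\<close>.\<close>

locale laver_node = regular_uncountable k for k :: "'k::wellorder itself" +
  fixes T :: "('k \<rightharpoonup> 'k) set" and s :: "'k \<rightharpoonup> 'k" and \<theta> :: 'k
  assumes tree: "tree T" and limit_closed: "limit_closed T"
    and s_in: "s \<in> T" and dom_s: "dom s = {..<\<theta>}"
    and card_Succ: "\<And>\<sigma>. \<sigma> \<in> T \<Longrightarrow> s \<subseteq>\<^sub>m \<sigma> \<Longrightarrow> |Succ T \<sigma>| =o (kappa :: 'k rel)"
begin

lemma ex_Succ_greater:
  assumes "\<sigma> \<in> T" "s \<subseteq>\<^sub>m \<sigma>" "dom \<sigma> = {..<\<mu>}"
  shows "\<exists>\<beta>>m. \<sigma>(\<mu> \<mapsto> \<beta>) \<in> T"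
proof -
  obtain \<beta> where \<beta>: "\<beta> \<in> Succ T \<sigma>" "m < \<beta>"
    using unbounded_of_card[OF card_Succ[OF assms(1,2)]] by blast
  then obtain \<alpha> where "dom \<sigma> = {..<\<alpha>}" "\<sigma>(\<alpha> \<mapsto> \<beta>) \<in> T" unfolding Succ_def by blast
  then show ?thesis using assms(3) \<beta>(2) by (metis lessThan_eq_iff)
qed

text \<open>The nodes \<open>n\<close> levels above \<open>\<sigma>\<close> whose new values are at most \<open>m\<close>; they need not lie in \<open>T\<close>.\<close>

primrec extensions :: "('k \<rightharpoonup> 'k) \<Rightarrow> 'k \<Rightarrow> 'k \<Rightarrow> nat \<Rightarrow> ('k \<rightharpoonup> 'k) set" where
  "extensions \<sigma> \<mu> m 0 = {\<sigma>}"
| "extensions \<sigma> \<mu> m (Suc n) =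
     {\<rho>((next_ordinal ^^ n) \<mu> \<mapsto> \<beta>) | \<rho> \<beta>. \<rho> \<in> extensions \<sigma> \<mu> m n \<and> \<beta> \<le> m}"

lemma extensions_mono: "m \<le> m' \<Longrightarrow> extensions \<sigma> \<mu> m n \<subseteq> extensions \<sigma> \<mu> m' n"
  by (induction n) (auto, blast intro: order_trans)

text \<open>Regularity is used once per level instead of counting nodes: bounding over the last
  value gives a function \<open>g\<close> of the shorter node, to which the induction hypothesis
  applies. Hence \<open>f\<close> is arbitrary.\<close>

lemma bounded_extensions: "\<exists>b::'k. \<forall>\<rho>\<in>extensions \<sigma> \<mu> m n. f \<rho> < b"
proof (induction n arbitrary: f)
  case 0
  then show ?case using ex_greater by auto
next
  case (Suc n)
  have "\<forall>\<rho>. \<exists>b. \<forall>\<beta>\<le>m. f (\<rho>((next_ordinal ^^ n) \<mu> \<mapsto> \<beta>)) < b"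
    by (intro allI bounded_atMost)
  then obtain g where g: "\<And>\<rho> \<beta>. \<beta> \<le> m \<Longrightarrow> f (\<rho>((next_ordinal ^^ n) \<mu> \<mapsto> \<beta>)) < g \<rho>" by metis
  obtain b where "\<And>\<rho>. \<rho> \<in> extensions \<sigma> \<mu> m n \<Longrightarrow> g \<rho> < b" using Suc[of g] by blast
  then have "\<forall>\<rho>\<in>extensions \<sigma> \<mu> m (Suc n). f \<rho> < b" using g by (auto intro: less_trans)
  then show ?case ..
qed

text \<open>Build \<omega> levels inside \<open>T\<close>, each new value above \<open>c n\<close>
  yet below \<delta>. Closure of \<delta> under \<open>h\<close> keeps the choices of
  \<open>nxt\<close> below \<delta>, and cofinality of \<open>c\<close> makes \<delta> the exact
  supremum.\<close>

lemma block_extension_through: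
  assumes \<sigma>: "\<sigma> \<in> T" "s \<subseteq>\<^sub>m \<sigma>" "dom \<sigma> = {..<\<mu>}"
    and L: "omega_limit (\<lambda>n. (next_ordinal ^^ n) \<mu>) L"
    and nxt: "\<And>\<rho> m n. \<rho> \<in> T \<Longrightarrow> s \<subseteq>\<^sub>m \<rho> \<Longrightarrow> dom \<rho> = {..<(next_ordinal ^^ n) \<mu>} \<Longrightarrow>
      m < nxt \<rho> n m \<and> \<rho>((next_ordinal ^^ n) \<mu> \<mapsto> nxt \<rho> n m) \<in> T"
    and h: "\<And>\<rho> m n. \<rho> \<in> extensions \<sigma> \<mu> m n \<Longrightarrow> nxt \<rho> n m < h m"
    and ran: "\<And>\<gamma>. \<gamma> < \<mu> \<Longrightarrow> the (\<sigma> \<gamma>) < \<delta>"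
    and \<delta>: "omega_limit c \<delta>" "\<And>m. m < \<delta> \<Longrightarrow> h m < \<delta>"
  shows "\<exists>\<tau>\<in>T. \<sigma> \<subseteq>\<^sub>m \<tau> \<and> dom \<tau> = {..<L} \<and> (LEAST \<eta>. \<forall>\<gamma><L. the (\<tau> \<gamma>) < \<eta>) = \<delta>"
proof -
  define p where "p n = (next_ordinal ^^ n) \<mu>" for n
  have p0: "p 0 = \<mu>" and pSuc: "p (Suc n) = next_ordinal (p n)" for n by (simp_all add: p_def)
  have pL: "p n < L" for n using L by (simp add: omega_limit_def p_def)
  have Lp: "\<exists>n. \<gamma> < p n" if "\<gamma> < L" for \<gamma> using L that by (simp add: omega_limit_def p_def)
  \<comment> \<open>The component \<open>m\<close> bounds the new values, is at least
    \<open>c n\<close> and stays below \<delta>, so that closure under \<open>h\<close> applies to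
    it.\<close>
  define A where "A n = (\<lambda>(\<rho>, m). \<rho> \<in> T \<and> \<sigma> \<subseteq>\<^sub>m \<rho> \<and> dom \<rho> = {..<p n} \<and>
      \<rho> \<in> extensions \<sigma> \<mu> m n \<and> c n \<le> m \<and> m < \<delta> \<and> (\<forall>\<gamma><p n. the (\<rho> \<gamma>) < \<delta>))" for n
  \<comment> \<open>\<open>Q\<close> remembers that the value added at level \<open>n\<close>
    exceeds \<open>c n\<close>, which finally gives cofinality in \<delta>.\<close>
  define Q where "Q n = (\<lambda>(\<rho> :: 'k \<rightharpoonup> 'k, m :: 'k) (\<rho>', m' :: 'k). \<exists>\<beta>>c n. \<rho>' = \<rho>(p n \<mapsto> \<beta>))" for n
  have "\<exists>f. \<forall>n. A n (f n) \<and> Q n (f n) (f (Suc n))"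
  proof (rule dependent_nat_choice)
    show "\<exists>x. A 0 x"
      using \<sigma> ran \<delta>(1) by (intro exI[of _ "(\<sigma>, c 0)"]) (auto simp: A_def p0 omega_limit_def)
  next
    fix x n assume "A n x"
    then obtain \<rho> m where x: "x = (\<rho>, m)" and \<rho>: "\<rho> \<in> T" "\<sigma> \<subseteq>\<^sub>m \<rho>" "dom \<rho> = {..<p n}"
        "\<rho> \<in> extensions \<sigma> \<mu> m n" "c n \<le> m" "m < \<delta>" "\<And>\<gamma>. \<gamma> < p n \<Longrightarrow> the (\<rho> \<gamma>) < \<delta>"
      by (cases x) (auto simp: A_def)
    define \<beta> where "\<beta> = nxt \<rho> n m"
    \<comment> \<open>The maximum bounds the new value and also catches up with the next term of
      \<open>c\<close>.\<close>
    define m' where "m' = max \<beta> (c (Suc n))"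
    have "s \<subseteq>\<^sub>m \<rho>" using \<sigma>(2) \<rho>(2) map_le_trans by blast
    then have \<beta>: "m < \<beta>" "\<rho>(p n \<mapsto> \<beta>) \<in> T"
      using nxt[OF \<rho>(1), of n m] \<rho>(3) by (auto simp: \<beta>_def p_def)
    have "\<beta> < \<delta>" using h[OF \<rho>(4)] \<delta>(2)[OF \<rho>(6)] by (auto simp: \<beta>_def)
    then have "m' < \<delta>" using \<delta>(1) by (auto simp: m'_def omega_limit_def)
    have "\<rho> \<in> extensions \<sigma> \<mu> m' n"
    proof -
      have "m \<le> m'" using \<beta>(1) by (simp add: m'_def le_max_iff_disj less_imp_le)
      then show ?thesis using extensions_mono \<rho>(4) by blast
    qed
    moreover have "\<beta> \<le> m'" by (simp add: m'_def)
    ultimately have "\<rho>(p n \<mapsto> \<beta>) \<in> extensions \<sigma> \<mu> m' (Suc n)" unfolding p_def by auto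
    moreover have "\<sigma> \<subseteq>\<^sub>m \<rho>(p n \<mapsto> \<beta>)"
    proof -
      have "p n \<notin> dom \<sigma>" using map_le_implies_dom_le[OF \<rho>(2)] \<rho>(3) by auto
      then show ?thesis using \<rho>(2) by (auto simp: map_le_def)
    qed
    moreover have "dom (\<rho>(p n \<mapsto> \<beta>)) = {..<p (Suc n)}"
      using \<rho>(3) by (auto simp: pSuc less_next_ordinal_iff)
    moreover have "the ((\<rho>(p n \<mapsto> \<beta>)) \<gamma>) < \<delta>" if "\<gamma> < p (Suc n)" for \<gamma>
      using that \<rho>(7) \<open>\<beta> < \<delta>\<close> by (auto simp: pSuc less_next_ordinal_iff)
    ultimately have "A (Suc n) (\<rho>(p n \<mapsto> \<beta>), m')"
      using \<beta>(2) \<open>m' < \<delta>\<close> by (auto simp: A_def m'_def)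
    moreover have "Q n x (\<rho>(p n \<mapsto> \<beta>), m')"
      unfolding Q_def x prod.case using le_less_trans[OF \<rho>(5) \<beta>(1)] by blast
    ultimately show "\<exists>y. A (Suc n) y \<and> Q n x y" by blast
  qed
  then obtain F where F: "\<And>n. A n (F n)" "\<And>n. Q n (F n) (F (Suc n))" by blast
  define f where "f n = fst (F n)" for n
  have f: "f n \<in> T" "\<sigma> \<subseteq>\<^sub>m f n" "dom (f n) = {..<p n}" "\<And>\<gamma>. \<gamma> < p n \<Longrightarrow> the (f n \<gamma>) < \<delta>" for n
    using F(1)[of n] by (auto simp: A_def f_def split_beta)
  have f_Suc: "\<exists>\<beta>>c n. f (Suc n) = (f n)(p n \<mapsto> \<beta>)" for n
    using F(2)[of n] by (auto simp: Q_def f_def split_beta)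
  have f_le_Suc: "f n \<subseteq>\<^sub>m f (Suc n)" for n
    using f_Suc[of n] f(3)[of n] by (auto simp: map_le_def)
  have f_mono: "f i \<subseteq>\<^sub>m f j" if "i \<le> j" for i j
    using that by (induction rule: dec_induct) (auto intro: map_le_trans[OF _ f_le_Suc])
  obtain \<tau> where dom_\<tau>: "dom \<tau> = (\<Union>n. dom (f n))" and f_\<tau>: "\<And>n. f n \<subseteq>\<^sub>m \<tau>"
    using ex_union[of UNIV f] f_mono nle_le by (metis UNIV_I)
  have dom: "dom \<tau> = {..<L}"
    unfolding dom_\<tau> f(3) using pL Lp by (auto intro: less_trans)
  have \<tau>_eq: "\<tau> \<gamma> = f n \<gamma>" if "\<gamma> < p n" for n \<gamma>
    using f_\<tau>[of n] f(3)[of n] that by (auto simp: map_le_def)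
  have "\<tau> \<in> T"
  proof (rule limit_closed_restrict[OF tree limit_closed _ dom])
    show "limit_ordinal L" using L by (rule omega_limit_imp_limit_ordinal)
  next
    fix \<alpha> assume "\<alpha> < L"
    then obtain n where n: "\<alpha> < p n" using Lp by blast
    have "\<tau> |` {..<\<alpha>} = f n |` {..<\<alpha>}"
      using \<tau>_eq n by (auto simp: restrict_map_def fun_eq_iff)
    then show "\<tau> |` {..<\<alpha>} \<in> T"
      using tree_restrict[OF tree f(1), of \<alpha> n] f(3) n by auto
  qed
  moreover have "\<sigma> \<subseteq>\<^sub>m \<tau>" using f(2) f_\<tau> map_le_trans by blast
  moreover have "(LEAST \<eta>. \<forall>\<gamma><L. the (\<tau> \<gamma>) < \<eta>) = \<delta>"
  proof (rule Least_equality)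
    show "\<forall>\<gamma><L. the (\<tau> \<gamma>) < \<delta>"
      using Lp \<tau>_eq f(4) by metis
  next
    fix \<eta> assume \<eta>: "\<forall>\<gamma><L. the (\<tau> \<gamma>) < \<eta>"
    show "\<delta> \<le> \<eta>"
    proof (rule ccontr)
      assume "\<not> \<delta> \<le> \<eta>"
      then obtain n where "\<eta> < c n" using \<delta>(1) by (auto simp: omega_limit_def not_le)
      moreover obtain \<beta> where \<beta>: "c n < \<beta>" "f (Suc n) (p n) = Some \<beta>"
        using f_Suc[of n] by auto
      have "\<tau> (p n) = Some \<beta>" using \<tau>_eq[of "p n" "Suc n"] \<beta>(2) less_next_ordinal pSuc by metis
      then have "\<beta> < \<eta>" using \<eta>[rule_format, OF pL[of n]] by simp
      ultimately show False using \<beta>(1) by (meson less_asym less_trans)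
    qed
  qed
  ultimately show ?thesis using dom by blast
qed

text \<open>Stationarity supplies a point of \<open>S\<close> closed under the bounds on successor
  choices; \<open>block_extension_through\<close> hits that point.\<close>

lemma block_extension:
  assumes \<sigma>: "\<sigma> \<in> T" "s \<subseteq>\<^sub>m \<sigma>" "dom \<sigma> = {..<\<mu>}"
    and L: "limit_ordinal L" "\<mu> < L" "\<And>l. limit_ordinal l \<Longrightarrow> \<mu> < l \<Longrightarrow> L \<le> l"
    and S: "stationary_cof_omega S"
  shows "\<exists>\<tau>\<in>T. \<sigma> \<subseteq>\<^sub>m \<tau> \<and> dom \<tau> = {..<L} \<and> (LEAST \<delta>. \<forall>\<gamma><L. the (\<tau> \<gamma>) < \<delta>) \<in> S"
proof -
  \<comment> \<open>The choices are fixed before \<delta> is known, so \<open>h\<close> does not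
    depend on \<delta>.\<close>
  define nxt where
    "nxt \<rho> n m = (SOME \<beta>. m < \<beta> \<and> \<rho>((next_ordinal ^^ n) \<mu> \<mapsto> \<beta>) \<in> T)" for \<rho> :: "'k \<rightharpoonup> 'k" and n m
  have nxt: "m < nxt \<rho> n m \<and> \<rho>((next_ordinal ^^ n) \<mu> \<mapsto> nxt \<rho> n m) \<in> T"
    if "\<rho> \<in> T" "s \<subseteq>\<^sub>m \<rho>" "dom \<rho> = {..<(next_ordinal ^^ n) \<mu>}" for \<rho> m n
    unfolding nxt_def using ex_Succ_greater[OF that, of m] by (rule someI_ex)
  have "\<forall>m. \<exists>h. \<forall>n. \<forall>\<rho>\<in>extensions \<sigma> \<mu> m n. nxt \<rho> n m < h"
  proof
    fix m
    have "\<forall>n. \<exists>b. \<forall>\<rho>\<in>extensions \<sigma> \<mu> m n. nxt \<rho> n m < b" by (intro allI bounded_extensions)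
    then obtain g where g: "\<And>n \<rho>. \<rho> \<in> extensions \<sigma> \<mu> m n \<Longrightarrow> nxt \<rho> n m < g n" by metis
    obtain b where "\<And>n. g n < b" using bounded_nat[of g] by blast
    then show "\<exists>h. \<forall>n. \<forall>\<rho>\<in>extensions \<sigma> \<mu> m n. nxt \<rho> n m < h" using g by (meson less_trans)
  qed
  then obtain h where h: "\<And>m n \<rho>. \<rho> \<in> extensions \<sigma> \<mu> m n \<Longrightarrow> nxt \<rho> n m < h m" by metis
  obtain b where b: "\<And>\<gamma>. \<gamma> < \<mu> \<Longrightarrow> the (\<sigma> \<gamma>) < b"
    using bounded_lessThan[of \<mu> "\<lambda>\<gamma>. the (\<sigma> \<gamma>)"] by blast
  \<comment> \<open>Including \<open>b\<close> puts \<delta> above the old values of \<sigma>, so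
    they cannot raise the supremum.\<close>
  obtain \<delta> c where \<delta>: "\<delta> \<in> S" "omega_limit c \<delta>" "\<And>\<alpha>. \<alpha> < \<delta> \<Longrightarrow> max b (h \<alpha>) < \<delta>"
    using S[unfolded stationary_cof_omega_def, rule_format, of "\<lambda>\<alpha>. max b (h \<alpha>)"] by blast
  have "b < \<delta>" using \<delta>(3)[OF omega_limit_less[OF \<delta>(2)]] by simp
  then have ran: "the (\<sigma> \<gamma>) < \<delta>" if "\<gamma> < \<mu>" for \<gamma> using b[OF that] by (rule less_trans[rotated])
  have "h \<alpha> < \<delta>" if "\<alpha> < \<delta>" for \<alpha> using \<delta>(3)[OF that] by simp
  then have "\<exists>\<tau>\<in>T. \<sigma> \<subseteq>\<^sub>m \<tau> \<and> dom \<tau> = {..<L} \<and> (LEAST \<eta>. \<forall>\<gamma><L. the (\<tau> \<gamma>) < \<eta>) = \<delta>"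
    using block_extension_through[OF \<sigma> omega_limit_least_limit[OF L], of nxt h \<delta> c] nxt h ran \<delta>(2)
    by simp
  then show ?thesis using \<delta>(1) by auto
qed

text \<open>Transfinite recursion over blocks. Blocks ending inside \<open>s\<close> copy
  \<open>s\<close>; later ones come from \<open>block_extension\<close>, with \<open>S\<close> or
  its complement according to \<open>t\<close>. Comparability with \<open>s\<close> is carried along
  for the passage between the two kinds.\<close>

lemma nodes_with_bits:
  assumes S: "stationary_cof_omega S" "stationary_cof_omega (- S)"
  obtains f where "\<And>\<alpha>. f \<alpha> \<in> T" "\<And>\<alpha>. dom (f \<alpha>) = {..<block_end \<alpha>}"
    "\<And>\<alpha> \<beta>. \<beta> < \<alpha> \<Longrightarrow> f \<beta> \<subseteq>\<^sub>m f \<alpha>" "\<And>\<alpha>. f \<alpha> \<subseteq>\<^sub>m s \<or> s \<subseteq>\<^sub>m f \<alpha>"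
    "\<And>\<alpha>. \<theta> < block_end \<alpha> \<Longrightarrow> block_bit S (f \<alpha>) \<alpha> = t \<alpha>"
proof -
  let ?P = "\<lambda>f \<alpha> r. r \<in> T \<and> dom r = {..<block_end \<alpha>} \<and> (\<forall>\<beta><\<alpha>. f \<beta> \<subseteq>\<^sub>m r) \<and>
    (r \<subseteq>\<^sub>m s \<or> s \<subseteq>\<^sub>m r) \<and> (\<theta> < block_end \<alpha> \<longrightarrow> block_bit S r \<alpha> = t \<alpha>)"
  have "\<exists>f. \<forall>\<alpha>. ?P f \<alpha> (f \<alpha>)"
  proof (rule dependent_wellorder_choice)
    fix r and f g :: "'k \<Rightarrow> 'k \<rightharpoonup> 'k" and x
    assume "\<And>y. y < x \<Longrightarrow> f y = g y"
    then show "?P f x r = ?P g x r" by simp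
  next
    fix x and f :: "'k \<Rightarrow> 'k \<rightharpoonup> 'k"
    assume "\<And>y. y < x \<Longrightarrow> ?P f y (f y)"
    then have f: "f y \<in> T" "dom (f y) = {..<block_end y}" "\<And>z. z < y \<Longrightarrow> f z \<subseteq>\<^sub>m f y"
      "f y \<subseteq>\<^sub>m s \<or> s \<subseteq>\<^sub>m f y" if "y < x" for y
      using that by auto
    have chain: "f y \<subseteq>\<^sub>m f z \<or> f z \<subseteq>\<^sub>m f y" if "y \<in> {..<x}" "z \<in> {..<x}" for y z
      using f(3) that by (cases y z rule: linorder_cases) auto
    obtain v where dom_v: "dom v = (\<Union>y\<in>{..<x}. dom (f y))" and f_v: "\<And>y. y < x \<Longrightarrow> f y \<subseteq>\<^sub>m v"
      using ex_union[of "{..<x}" f, OF chain] by auto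
    have dom: "dom v = {..<block_start x}"
    proof -
      have "dom v = (\<Union>y\<in>{..<x}. {..<block_end y})" unfolding dom_v using f(2) by simp
      also have "\<dots> = {..<block_start x}"
        using block_end_le_block_start by (auto dest: less_block_startD intro: less_le_trans)
      finally show ?thesis .
    qed
    have v_restrict: "v |` {..<\<alpha>} \<in> T" if "\<alpha> \<le> block_end y" "y < x" for \<alpha> y
    proof -
      have "v |` {..<\<alpha>} = f y |` {..<\<alpha>}"
        using f_v[OF that(2)] f(2)[OF that(2)] that(1)
        by (auto simp: map_le_def restrict_map_def fun_eq_iff)
      then show ?thesis using tree_restrict[OF tree f(1)[OF that(2)], of \<alpha>] f(2)[OF that(2)] that(1)
        by auto
    qed
    \<comment> \<open>Three cases: \<open>block_start x\<close> is the end of an earlier block, a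
      limit of such ends, or zero, where \<open>v\<close> is empty.\<close>
    have v: "v \<in> T"
    proof (cases "\<exists>y<x. block_end y = block_start x")
      case True
      then obtain y where y: "y < x" "block_end y = block_start x" by blast
      have "v |` {..<block_start x} = v" unfolding dom[symmetric] by (simp add: restrict_map_def fun_eq_iff domIff)
      then show ?thesis using v_restrict[of "block_start x" y] y by simp
    next
      case False
      then have less: "block_end y < block_start x" if "y < x" for y
        using block_end_le_block_start[OF that] that by (auto simp: less_le)
      show ?thesis
      proof (cases "\<exists>\<gamma>. \<gamma> < block_start x")
        case True
        have "limit_ordinal (block_start x)"
          unfolding limit_ordinal_def using True less less_block_startD by blast
        moreover have "v |` {..<\<alpha>} \<in> T" if "\<alpha> < block_start x" for \<alpha>
          using less_block_startD[OF that] v_restrict by (meson less_imp_le)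
        ultimately show ?thesis using limit_closed_restrict[OF tree limit_closed _ dom] by blast
      next
        case False
        then have "dom v = {}" "v \<subseteq>\<^sub>m s" using dom by (auto simp: map_le_def)
        moreover have "v \<in> seqs" unfolding seqs_def using dom by blast
        ultimately show ?thesis using s_in tree unfolding tree_def by blast
      qed
    qed
    have comp: "v \<subseteq>\<^sub>m s \<or> s \<subseteq>\<^sub>m v"
    proof (cases "\<exists>y<x. s \<subseteq>\<^sub>m f y")
      case True
      then show ?thesis using f_v map_le_trans by blast
    next
      case False
      then have below: "f y \<subseteq>\<^sub>m s" if "y < x" for y using f(4) that by blast
      have "v \<subseteq>\<^sub>m s"
        unfolding map_le_def
      proof
        fix \<gamma> assume "\<gamma> \<in> dom v"
        then obtain y where y: "y < x" "\<gamma> \<in> dom (f y)" unfolding dom_v by blast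
        then show "v \<gamma> = s \<gamma>"
          using below[OF y(1)] f_v[OF y(1)] by (auto simp: map_le_def dest!: bspec[of _ _ \<gamma>])
      qed
      then show ?thesis ..
    qed
    show "\<exists>r. ?P f x r"
    proof (cases "block_end x \<le> \<theta>")
      case True
      define r where "r = s |` {..<block_end x}"
      have r: "r \<in> T" unfolding r_def using tree_restrict[OF tree s_in] dom_s True by auto
      have "dom r = {..<block_end x}" unfolding r_def using dom_s True by auto
      moreover have "r \<subseteq>\<^sub>m s" unfolding r_def by (auto simp: map_le_def)
      moreover have "v \<subseteq>\<^sub>m r"
      proof -
        have "block_start x < \<theta>" using block_start_less_block_end True by (rule less_le_trans)
        then have "\<not> s \<subseteq>\<^sub>m v" using map_le_implies_dom_le[of s v] dom dom_s by auto
        then have "v \<subseteq>\<^sub>m s" using comp by blast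
        then show ?thesis unfolding r_def map_le_def
          using dom block_start_less_block_end[of x] by (auto simp: restrict_map_def)
      qed
      then have "f y \<subseteq>\<^sub>m r" if "y < x" for y using f_v[OF that] map_le_trans by blast
      ultimately show ?thesis using r True by (intro exI[of _ r]) auto
    next
      case False
      \<comment> \<open>\<open>w\<close> is the longer of \<open>v\<close> and \<open>s\<close>: a
        block in which \<open>s\<close> ends is completed from \<open>s\<close>, and the next limit
        after \<mu> is still \<open>block_end x\<close>.\<close>
      define w \<mu> where "w = (if s \<subseteq>\<^sub>m v then v else s)" and "\<mu> = max \<theta> (block_start x)"
      have w: "w \<in> T" "s \<subseteq>\<^sub>m w" "v \<subseteq>\<^sub>m w"
        using v s_in comp by (auto simp: w_def)
      have dom_w: "dom w = {..<\<mu>}"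
        using comp map_le_implies_dom_le[of s v] map_le_implies_dom_le[of v s] dom dom_s
        by (auto simp: w_def \<mu>_def max_def)
      have \<mu>: "\<mu> < block_end x" using False block_start_less_block_end by (auto simp: \<mu>_def)
      have least: "block_end x \<le> l" if "limit_ordinal l" "\<mu> < l" for l
        using block_end_least[OF that(1)] that(2) by (auto simp: \<mu>_def)
      obtain r where r: "r \<in> T" "w \<subseteq>\<^sub>m r" "dom r = {..<block_end x}" "block_bit S r x = t x"
        using block_extension[OF w(1,2) dom_w limit_block_end \<mu> least S(1)]
          block_extension[OF w(1,2) dom_w limit_block_end \<mu> least S(2)]
        unfolding block_bit_def by (cases "t x") auto
      have "f y \<subseteq>\<^sub>m r" if "y < x" for y using f_v[OF that] w(3) r(2) map_le_trans by blast
      moreover have "s \<subseteq>\<^sub>m r" using w(2) r(2) map_le_trans by blast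
      ultimately show ?thesis using r by blast
    qed
  qed
  then obtain f where "\<forall>\<alpha>. ?P f \<alpha> (f \<alpha>)" ..
  then show ?thesis by (intro that[of f]) auto
qed

end

text \<open>A combinatorial form of forcing a bit. It is vacuous if \<open>T\<close> has no long
  enough node, which \<open>ex_long_node\<close> excludes for Laver trees.\<close>

definition decides :: "'k set \<Rightarrow> ('k::wellorder \<rightharpoonup> 'k) set \<Rightarrow> 'k \<Rightarrow> bool \<Rightarrow> bool" where
  "decides S T \<alpha> i \<longleftrightarrow> (\<forall>\<tau>\<in>T. {..<block_end \<alpha>} \<subseteq> dom \<tau> \<longrightarrow> block_bit S \<tau> \<alpha> = i)"

text \<open>A node covering the block, whether above or below \<tau>, agrees with \<tau>
  there.\<close>

lemma decides_restrict_tree: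
  assumes "{..<block_end \<alpha>} \<subseteq> dom \<tau>"
  shows "decides S (T \<up> \<tau>) \<alpha> (block_bit S \<tau> \<alpha>)"
  using block_bit_mono assms unfolding decides_def restrict_tree_def by blast

context regular_uncountable
begin

lemma Laver_trees_node:
  assumes "T \<in> Laver_trees"
  obtains s \<theta> where "laver_node T s (\<theta>::'k)"
proof -
  obtain s where s: "tree T" "limit_closed T" "s \<in> T"
      "\<forall>\<sigma>\<in>T. s \<subseteq>\<^sub>m \<sigma> \<longrightarrow> |Succ T \<sigma>| =o (kappa :: 'k rel)"
    using assms by (auto simp: Laver_trees_def is_stem_def)
  then obtain \<theta> where "dom s = {..<\<theta>}" unfolding tree_def seqs_def by auto
  with s have "laver_node T s \<theta>" by unfold_locales auto
  then show ?thesis by (rule that)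
qed

lemma ex_long_node:
  fixes \<alpha> :: 'k
  assumes "T \<in> Laver_trees"
  shows "\<exists>\<tau>\<in>T. {..<block_end \<alpha>} \<subseteq> dom \<tau>"
proof -
  obtain s \<theta> where "laver_node T s (\<theta>::'k)" using assms by (rule Laver_trees_node)
  then interpret laver_node k T s \<theta> .
  obtain S :: "'k set" where "stationary_cof_omega S" "stationary_cof_omega (- S)"
    using ex_stationary_split by blast
  from nodes_with_bits[OF this] obtain f where "f \<alpha> \<in> T" "dom (f \<alpha>) = {..<block_end \<alpha>}"
    by metis
  then show ?thesis by blast
qed

text \<open>The stem fixes the bits of the blocks it contains. These form a Cohen condition; a
  member \<open>t\<close> of \<open>D\<close> extends it, and \<open>nodes_with_bits\<close>
  realises the remaining bits of \<open>t\<close>.\<close>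

lemma ex_node_deciding_dense:
  fixes S :: "'k set"
  assumes T: "T \<in> Laver_trees" and S: "stationary_cof_omega S" "stationary_cof_omega (- S)"
    and D: "D \<in> Cohen_dense"
  shows "\<exists>\<tau>\<in>T. \<exists>t\<in>D. \<forall>(\<alpha>, i)\<in>Map.graph t. decides S (T \<up> \<tau>) \<alpha> i"
proof -
  obtain s \<theta> where "laver_node T s (\<theta>::'k)" using T by (rule Laver_trees_node)
  then interpret laver_node k T s \<theta> .
  \<comment> \<open>The first block to pass the end of \<open>s\<close>; the blocks before it are
    those contained in \<open>s\<close>.\<close>
  define \<alpha>0 where "\<alpha>0 = (LEAST \<alpha>. \<theta> < block_end \<alpha>)"
  have "\<exists>\<alpha>. \<theta> < block_end \<alpha>" using ex_greater le_block_end by (meson less_le_trans)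
  then have "\<theta> < block_end \<alpha>0" unfolding \<alpha>0_def by (rule LeastI_ex)
  then have less_\<alpha>0: "\<alpha> < \<alpha>0" if "block_end \<alpha> \<le> \<theta>" for \<alpha>
    using block_end_strict_mono that by (metis leD less_le_trans linorder_cases less_trans)
  define t0 where "t0 = (\<lambda>\<alpha>. Some (block_bit S s \<alpha>)) |` {..<\<alpha>0}"
  have "t0 \<in> seqs" unfolding seqs_def t0_def by (auto simp: dom_def restrict_map_def)
  then obtain t where t: "t \<in> D" "t0 \<subseteq>\<^sub>m t" using D unfolding Cohen_dense_def by blast
  then obtain \<nu> where \<nu>: "dom t = {..<\<nu>}" using D unfolding Cohen_dense_def seqs_def by blast
  obtain f where
    f: "\<And>\<alpha>. f \<alpha> \<in> T" "\<And>\<alpha>. dom (f \<alpha>) = {..<block_end \<alpha>}" "\<And>\<alpha> \<beta>. \<beta> < \<alpha> \<Longrightarrow> f \<beta> \<subseteq>\<^sub>m f \<alpha>"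
      "\<And>\<alpha>. f \<alpha> \<subseteq>\<^sub>m s \<or> s \<subseteq>\<^sub>m f \<alpha>" "\<And>\<alpha>. \<theta> < block_end \<alpha> \<Longrightarrow> block_bit S (f \<alpha>) \<alpha> = the (t \<alpha>)"
    by (rule nodes_with_bits[OF S, of "\<lambda>\<alpha>. the (t \<alpha>)"]) (rule that)
  \<comment> \<open>\<open>f \<nu>\<close> has length \<open>block_end \<nu>\<close>, so it covers
    every block indexed in the domain of \<open>t\<close>.\<close>
  have "decides S (T \<up> f \<nu>) \<alpha> i" if "t \<alpha> = Some i" for \<alpha> i
  proof -
    have "\<alpha> < \<nu>" using that \<nu> by blast
    then have long: "{..<block_end \<alpha>} \<subseteq> dom (f \<nu>)"
      using f(2) block_end_strict_mono by (simp add: less_imp_le)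
    have "block_bit S (f \<alpha>) \<alpha> = i"
    proof (cases "\<theta> < block_end \<alpha>")
      case True
      then show ?thesis using f(5) that by simp
    next
      case False
      then have le: "block_end \<alpha> \<le> \<theta>" by simp
      then have sub: "{..<block_end \<alpha>} \<subseteq> dom s" using dom_s by auto
      have "block_bit S (f \<alpha>) \<alpha> = block_bit S s \<alpha>"
        using f(4)[of \<alpha>] block_bit_mono[of "f \<alpha>" s \<alpha> S] block_bit_mono[of s "f \<alpha>" \<alpha> S] f(2) sub by auto
      moreover have "t \<alpha> = Some (block_bit S s \<alpha>)"
        using t(2) less_\<alpha>0[OF le] unfolding t0_def map_le_def
        by (auto simp: dom_def restrict_map_def)
      ultimately show ?thesis using that by simp
    qed
    then have "block_bit S (f \<nu>) \<alpha> = i" using block_bit_mono[OF f(3)[OF \<open>\<alpha> < \<nu>\<close>], of \<alpha> S] f(2) by simp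
    then show ?thesis using decides_restrict_tree[OF long, of S T] by simp
  qed
  then show ?thesis
    using f(1) t(1) by (intro bexI[of _ "f \<nu>"] bexI[of _ t]) (auto simp: Map.graph_def)
qed

end


section \<open>Forcing with check names\<close>

lemma forces_eq_refl: "forces_eq P x x p"
proof (induction x arbitrary: p rule: wf_induct_rule[OF wf_elt_rel])
  case (1 x)
  have IH: "forces_eq P c c s" if "(c, r) \<in> elts x" for c r s
    using 1 that by (auto simp: elt_rel_def)
  have "forces_mem P c x q" if "(c, r) \<in> elts x" "q \<le> r" for c r q
    unfolding forces_mem_def dense_below_def
  proof (intro ballI impI)
    fix s assume "s \<in> P" "s \<le> q"
    moreover have "s \<le> r" using \<open>s \<le> q\<close> that(2) by (rule order_trans)
    ultimately show "\<exists>s'\<in>P. s' \<le> s \<and> (\<exists>(d, u)\<in>elts x. s' \<le> u \<and> forces_eq P c d s')"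
      using IH[OF that(1)] that(1) by blast
  qed
  then show ?case unfolding forces_eq_iff[of P x x] by blast
qed

lemma forces_eq_antimono: "forces_eq P x y p \<Longrightarrow> q \<le> p \<Longrightarrow> forces_eq P x y q"
  unfolding forces_eq_iff[of P x y] by (blast intro: order_trans)

lemma forces_mem_antimono: "forces_mem P x y p \<Longrightarrow> q \<le> p \<Longrightarrow> forces_mem P x y q"
  unfolding forces_mem_def dense_below_def by (meson order_trans)

text \<open>Names whose elements carry every condition behave like check names. Some
  \<open>q\<close> in \<open>P\<close> suffices for the refutations that follow.\<close>

lemma forces_eq_checkD:
  assumes "forces_eq P x y p" "p \<in> P" "elts x = A \<times> P" "elts y = B \<times> P" "a \<in> A"
  shows "\<exists>b\<in>B. \<exists>q\<in>P. forces_eq P a b q"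
  using assms unfolding forces_eq.simps[of P x y] dense_below_def by fastforce

lemma elts_bit_name: "elts (bit_name P i) = (if i then {Name (\<lambda>_. None)} else {}) \<times> P"
  by (auto simp: bit_name_def Let_def elts_upair_name)

text \<open>Emptiness tells the two bits apart, and for such names it does not depend on the
  condition.\<close>

lemma forces_eq_check_bit:
  assumes eq: "forces_eq P x (bit_name P i) p" and p: "p \<in> P" and elts: "elts x = A \<times> P"
  shows "A \<noteq> {} \<longleftrightarrow> i"
  using forces_eq_checkD[OF eq p elts elts_bit_name]
    forces_eq_checkD[OF eq[unfolded forces_eq_sym[of P x]] p elts_bit_name elts]
  by (auto split: if_splits)

text \<open>If \<alpha> < \<beta>, then \<alpha> as an element of \<beta> must equal some \<gamma> <
  \<alpha>, a smaller counterexample.\<close>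

lemma forces_eq_ordinal_name:
  fixes \<alpha> \<beta> :: "'k::wellorder"
  assumes "forces_eq P (ordinal_name P \<alpha>) (ordinal_name P \<beta>) p" "p \<in> P"
  shows "\<alpha> = \<beta>"
proof -
  have elts: "elts (ordinal_name P \<alpha>) = ordinal_name P ` {..<\<alpha>} \<times> P" for \<alpha> :: 'k
    by (auto simp: elts_ordinal_name)
  have "\<not> \<alpha> < \<beta>" if "forces_eq P (ordinal_name P \<alpha>) (ordinal_name P \<beta>) p" "p \<in> P" for \<alpha> \<beta> :: 'k and p
    using that
  proof (induction \<alpha> arbitrary: \<beta> p rule: less_induct)
    case (less \<alpha>)
    show ?case
    proof
      assume "\<alpha> < \<beta>"
      then obtain \<gamma> q where "\<gamma> < \<alpha>" "q \<in> P" "forces_eq P (ordinal_name P \<alpha>) (ordinal_name P \<gamma>) q"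
        using forces_eq_checkD[OF less.prems(1)[unfolded forces_eq_sym[of P "ordinal_name P \<alpha>"]]
            less.prems(2) elts elts, of "ordinal_name P \<alpha>"] by auto
      then show False using less.IH[of \<gamma> \<alpha> q] forces_eq_sym by blast
    qed
  qed
  then show ?thesis using assms forces_eq_sym by (metis linorder_cases)
qed

lemma forces_eq_bit_name:
  assumes "forces_eq P (bit_name P i) (bit_name P j) p" "p \<in> P"
  shows "i = j"
proof -
  from forces_eq_check_bit[OF assms elts_bit_name] show ?thesis by (auto split: if_splits)
qed

lemma forces_eq_upairD:
  assumes "forces_eq P (upair_name P x y) (upair_name P x' y') p" "p \<in> P"
  shows "\<exists>q\<in>P. forces_eq P x x' q \<or> forces_eq P x y' q" "\<exists>q\<in>P. forces_eq P y x' q \<or> forces_eq P y y' q"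
    "\<exists>q\<in>P. forces_eq P x x' q \<or> forces_eq P y x' q" "\<exists>q\<in>P. forces_eq P x y' q \<or> forces_eq P y y' q"
  using forces_eq_checkD[OF assms elts_upair_name elts_upair_name]
    forces_eq_checkD[OF assms(1)[unfolded forces_eq_sym[of P "upair_name P x y"]] assms(2) elts_upair_name elts_upair_name]
  by (auto simp: forces_eq_sym[of P _ x] forces_eq_sym[of P _ y]) 

text \<open>In Kuratowski pairs the singleton of \<open>x'\<close> matches one of the two sets on
  the left, and both contain \<open>x\<close>.\<close>

lemma forces_eq_pair_name_ordinal:
  assumes "forces_eq P (pair_name P x y) (pair_name P x' y') p" "p \<in> P"
  shows "\<exists>q\<in>P. forces_eq P x x' q"
  using forces_eq_upairD(3)[OF assms[unfolded pair_name_def]] forces_eq_upairD(1) by blast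

text \<open>Bits are themselves the ordinals 0 and 1, so \<alpha> may coincide with one of them.
  Since the bits differ, matching the doubletons would make \<alpha> equal to both 1 and 0.\<close>

lemma forces_eq_pair_name_bit:
  assumes eq: "forces_eq P (pair_name P (ordinal_name P \<alpha>) (bit_name P False))
      (pair_name P (ordinal_name P \<alpha>) (bit_name P True)) p" "p \<in> P"
  shows False
proof -
  have elts: "elts (ordinal_name P \<alpha>) = ordinal_name P ` {..<\<alpha>} \<times> P"
    by (auto simp: elts_ordinal_name)
  note eq = eq[unfolded pair_name_def]
  have "\<exists>q\<in>P. forces_eq P (ordinal_name P \<alpha>) (bit_name P True) q"
    using forces_eq_upairD(4)[OF eq] forces_eq_upairD(4) forces_eq_bit_name by blast
  moreover have "\<exists>q\<in>P. forces_eq P (ordinal_name P \<alpha>) (bit_name P False) q"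
    using forces_eq_upairD(2)[OF eq] forces_eq_upairD(2) forces_eq_bit_name forces_eq_sym by blast
  ultimately show False
    using forces_eq_check_bit[OF _ _ elts] by blast
qed

lemma forces_eq_pair_nameD:
  assumes "forces_eq P (pair_name P (ordinal_name P \<alpha>) (bit_name P i))
      (pair_name P (ordinal_name P \<beta>) (bit_name P j)) p" "p \<in> P"
  shows "\<alpha> = \<beta> \<and> i = j"
proof -
  have "\<alpha> = \<beta>"
    using forces_eq_pair_name_ordinal[OF assms] forces_eq_ordinal_name by blast
  then show ?thesis
    using assms(1) assms(1)[unfolded forces_eq_sym[of P "pair_name P (ordinal_name P \<alpha>) (bit_name P i)"]]
      forces_eq_pair_name_bit[OF _ assms(2), of \<alpha>]
    by (cases i; cases j) simp_all
qed

lemma is_name_ordinal_name: "is_name P (ordinal_name P \<alpha>)"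
  by (induction \<alpha> rule: less_induct) (rule is_name.intros, auto simp: elts_ordinal_name)

lemma is_name_upair_name: "is_name P x \<Longrightarrow> is_name P y \<Longrightarrow> is_name P (upair_name P x y)"
  by (rule is_name.intros) (auto simp: elts_upair_name)

lemma is_name_empty: "is_name P (Name (\<lambda>_. None))"
  by (rule is_name.intros) auto

lemma is_name_bit_name: "is_name P (bit_name P i)"
  by (simp add: bit_name_def Let_def is_name_upair_name is_name_empty)

lemma is_name_pair_name: "is_name P x \<Longrightarrow> is_name P y \<Longrightarrow> is_name P (pair_name P x y)"
  by (simp add: pair_name_def is_name_upair_name)


section \<open>The name of the Cohen real\<close>

text \<open>Attaching each bit to the conditions that decide it avoids a name for the generic
  branch.\<close>

definition Cohen_name ::
    "'k set \<Rightarrow> ('k::wellorder \<rightharpoonup> 'k) set set \<Rightarrow> ('k, ('k \<rightharpoonup> 'k) set) kname" where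
  "Cohen_name S P = Name (\<lambda>(\<alpha>, i, p). if p \<in> P \<and> decides S p \<alpha> i
     then Some (pair_name P (ordinal_name P \<alpha>) (bit_name P i), p) else None)"

lemma elts_Cohen_name:
  "elts (Cohen_name S P) = {(pair_name P (ordinal_name P \<alpha>) (bit_name P i), p) | \<alpha> i p.
     p \<in> P \<and> decides S p \<alpha> i}"
  by (auto simp: Cohen_name_def ran_def split: if_splits)

lemma is_name_Cohen_name: "is_name P (Cohen_name S P)"
  by (rule is_name.intros)
    (auto simp: elts_Cohen_name intro: is_name_pair_name is_name_ordinal_name is_name_bit_name)

lemma decides_antimono: "decides S p \<alpha> i \<Longrightarrow> q \<subseteq> p \<Longrightarrow> decides S q \<alpha> i"
  unfolding decides_def by blast

lemma forces_val_Cohen_nameI: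
  assumes "p \<in> P" "decides S p \<alpha> i"
  shows "forces_val P (Cohen_name S P) \<alpha> i p"
  unfolding forces_val_def forces_mem_def dense_below_def
proof (intro ballI impI)
  let ?c = "pair_name P (ordinal_name P \<alpha>) (bit_name P i)"
  fix q assume q: "q \<in> P" "q \<le> p"
  have "(?c, p) \<in> elts (Cohen_name S P)" using assms by (auto simp: elts_Cohen_name)
  then show "\<exists>r\<in>P. r \<le> q \<and> (\<exists>(d, u)\<in>elts (Cohen_name S P). r \<le> u \<and> forces_eq P ?c d r)"
    using q forces_eq_refl[of P ?c q] by blast
qed

lemma forces_mem_Cohen_nameD:
  assumes "forces_mem P y (Cohen_name S P) p" "p \<in> P"
  obtains q \<alpha> i where "q \<in> P" "q \<subseteq> p" "decides S q \<alpha> i"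
    "forces_eq P y (pair_name P (ordinal_name P \<alpha>) (bit_name P i)) q"
proof -
  obtain q d u where q: "q \<in> P" "q \<subseteq> p" "(d, u) \<in> elts (Cohen_name S P)" "q \<subseteq> u" "forces_eq P y d q"
    using assms(1)[unfolded forces_mem_def dense_below_def, rule_format, OF assms(2) order_refl] by blast
  from q(3) obtain \<alpha> i where
    "d = pair_name P (ordinal_name P \<alpha>) (bit_name P i)" "decides S u \<alpha> i"
    by (auto simp: elts_Cohen_name)
  then show ?thesis using q decides_antimono[OF _ q(4)] by (intro that[of q \<alpha> i]) simp_all
qed

text \<open>Converse of \<open>forces_val_Cohen_nameI\<close> up to strengthening; distinct pairs
  have names that are never forced equal.\<close>

lemma forces_val_Cohen_nameD:
  assumes "forces_val P (Cohen_name S P) \<alpha> i p" "p \<in> P"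
  shows "\<exists>q\<in>P. q \<subseteq> p \<and> decides S q \<alpha> i"
proof -
  obtain q \<beta> j where q: "q \<in> P" "q \<subseteq> p" "decides S q \<beta> j"
    "forces_eq P (pair_name P (ordinal_name P \<alpha>) (bit_name P i))
      (pair_name P (ordinal_name P \<beta>) (bit_name P j)) q"
    using assms unfolding forces_val_def by (rule forces_mem_Cohen_nameD)
  from forces_eq_pair_nameD[OF q(4,1)] show ?thesis using q(1-3) by blast
qed

lemma restrict_tree_subset: "T \<up> \<sigma> \<subseteq> T"
  unfolding restrict_tree_def by blast

context regular_uncountable
begin

text \<open>Totality: restricting to a node that covers the block decides the bit.
  Single-valuedness: a condition deciding both values would contain a node with two different
  bits.\<close>

lemma forces_Cohen_name_in_2_kappa:
  fixes P :: "('k \<rightharpoonup> 'k) set set"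
  assumes P: "P \<subseteq> Laver_trees" and closed: "\<And>T \<sigma>. T \<in> P \<Longrightarrow> \<sigma> \<in> T \<Longrightarrow> T \<up> \<sigma> \<in> P"
  shows "forces_in_2_kappa P (Cohen_name S P) p"
proof -
  have subset: "forces_ex P UNIV (\<lambda>\<alpha>. forces_ex P UNIV (\<lambda>i.
      forces_eq P y (pair_name P (ordinal_name P \<alpha>) (bit_name P i)))) q"
    if mem: "forces_mem P y (Cohen_name S P) q" for y q
    unfolding forces_ex_def[of P "UNIV :: 'k set"] dense_below_def
  proof (intro ballI impI)
    fix q' assume q': "q' \<in> P" "q' \<le> q"
    obtain r \<alpha> i where r: "r \<in> P" "r \<subseteq> q'" "decides S r \<alpha> i"
      "forces_eq P y (pair_name P (ordinal_name P \<alpha>) (bit_name P i)) r"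
      using forces_mem_antimono[OF mem q'(2)] q'(1) by (rule forces_mem_Cohen_nameD)
    \<comment> \<open>The inner existential is again a density statement, so the forced equality has
      to persist below \<open>r\<close>.\<close>
    have "forces_ex P UNIV (\<lambda>i. forces_eq P y (pair_name P (ordinal_name P \<alpha>) (bit_name P i))) r"
      unfolding forces_ex_def dense_below_def using forces_eq_antimono[OF r(4)] by blast
    then show "\<exists>r\<in>P. r \<le> q' \<and> (\<exists>\<alpha>\<in>UNIV. forces_ex P UNIV (\<lambda>i.
        forces_eq P y (pair_name P (ordinal_name P \<alpha>) (bit_name P i))) r)"
      using r(1,2) by blast
  qed
  have total: "forces_ex P UNIV (\<lambda>i. forces_val P (Cohen_name S P) \<alpha> i) p" for \<alpha>
    unfolding forces_ex_def dense_below_def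
  proof (intro ballI impI)
    fix q assume q: "q \<in> P"
    then obtain \<tau> where \<tau>: "\<tau> \<in> q" "{..<block_end \<alpha>} \<subseteq> dom \<tau>"
      using P ex_long_node by blast
    have "forces_val P (Cohen_name S P) \<alpha> (block_bit S \<tau> \<alpha>) (q \<up> \<tau>)"
      using closed[OF q \<tau>(1)] decides_restrict_tree[OF \<tau>(2)] by (rule forces_val_Cohen_nameI)
    then show "\<exists>r\<in>P. r \<le> q \<and> (\<exists>i\<in>UNIV. forces_val P (Cohen_name S P) \<alpha> i r)"
      using closed[OF q \<tau>(1)] restrict_tree_subset by blast
  qed
  have single: "forces_not P (forces_and (forces_val P (Cohen_name S P) \<alpha> False)
      (forces_val P (Cohen_name S P) \<alpha> True)) p" for \<alpha>
    unfolding forces_not_def forces_and_def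
  proof (intro ballI impI notI)
    fix q assume q: "q \<in> P"
      "forces_val P (Cohen_name S P) \<alpha> False q \<and> forces_val P (Cohen_name S P) \<alpha> True q"
    then obtain r where r: "r \<in> P" "r \<subseteq> q" "decides S r \<alpha> False"
      using forces_val_Cohen_nameD by blast
    then have "forces_val P (Cohen_name S P) \<alpha> True r"
      using q(2) forces_mem_antimono unfolding forces_val_def by blast
    then obtain r' where r': "r' \<in> P" "r' \<subseteq> r" "decides S r' \<alpha> True"
      using forces_val_Cohen_nameD[OF _ r(1)] by blast
    then obtain \<tau> where "\<tau> \<in> r'" "{..<block_end \<alpha>} \<subseteq> dom \<tau>" using P ex_long_node by blast
    then show False using r(3) r'(2,3) unfolding decides_def by blast
  qed
  show ?thesis
    unfolding forces_in_2_kappa_def forces_and_def[abs_def] forces_all_def forces_imp_def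
    using subset total single unfolding forces_and_def[abs_def] by blast
qed

text \<open>The single condition \<open>q \<up> \<tau>\<close> decides all bits of some
  \<open>t\<close> in \<open>D\<close> at once, which gives density below every condition.\<close>

lemma forces_Cohen_name_generic:
  fixes P :: "('k \<rightharpoonup> 'k) set set"
  assumes P: "P \<subseteq> Laver_trees" and closed: "\<And>T \<sigma>. T \<in> P \<Longrightarrow> \<sigma> \<in> T \<Longrightarrow> T \<up> \<sigma> \<in> P"
    and S: "stationary_cof_omega S" "stationary_cof_omega (- S)"
  shows "forces_Cohen_generic P (Cohen_name S P) p"
  unfolding forces_Cohen_generic_def forces_all_def forces_ex_def dense_below_def
proof (intro ballI impI)
  fix D q assume D: "D \<in> (Cohen_dense :: ('k \<rightharpoonup> bool) set set)" and q: "q \<in> P"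
  then obtain \<tau> t where t: "\<tau> \<in> q" "t \<in> D" "\<forall>(\<alpha>, i)\<in>Map.graph t. decides S (q \<up> \<tau>) \<alpha> i"
    using ex_node_deciding_dense[OF _ S D] P by blast
  have "\<forall>(\<alpha>, i)\<in>Map.graph t. forces_val P (Cohen_name S P) \<alpha> i (q \<up> \<tau>)"
    using t(3) forces_val_Cohen_nameI[OF closed[OF q t(1)]] by blast
  then show "\<exists>r\<in>P. r \<le> q \<and> (\<exists>t\<in>D. \<forall>a\<in>Map.graph t.
      (case a of (\<alpha>, i) \<Rightarrow> forces_val P (Cohen_name S P) \<alpha> i) r)"
    using closed[OF q t(1)] restrict_tree_subset t(2) by (intro bexI[of _ "q \<up> \<tau>"]) fastforce+
qed

end

theorem theorem1:
  fixes P :: "('k::wellorder \<rightharpoonup> 'k) set set"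
  assumes "Card_order (kappa :: 'k rel)"
    and "regularCard (kappa :: 'k rel)"
    and "natLeq <o (kappa :: 'k rel)"
    and "P \<subseteq> Laver_trees"
    and "\<And>T \<sigma>. T \<in> P \<Longrightarrow> \<sigma> \<in> T \<Longrightarrow> T \<up> \<sigma> \<in> P"
  shows "adds_Cohen_real TYPE('k) P"
proof -
  interpret regular_uncountable "TYPE('k)" by unfold_locales fact+
  obtain S :: "'k set" where S: "stationary_cof_omega S" "stationary_cof_omega (- S)"
    using ex_stationary_split by blast
  \<comment> \<open>One name serves all conditions, so each condition is its own witness for
    density.\<close>
  have "forces_and (forces_in_2_kappa P (Cohen_name S P)) (forces_Cohen_generic P (Cohen_name S P)) q"
    for q
    unfolding forces_and_def
    using forces_Cohen_name_in_2_kappa forces_Cohen_name_generic assms(4,5) S by blast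
  then show ?thesis
    unfolding adds_Cohen_real_def forces_ex_def dense_below_def
    using is_name_Cohen_name by blast
qed

end
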